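(* Let $(\Sigma)$: $\dot g=\mathcal X(g)+\sum_{j=1}^m u_jB_j(g)$ be a linear system with $m$ inputs on the generalized Heisenberg group $\mathbb{H}^n$, with $B_1,\dots,B_m$ linearly independent and pairwise commuting, with $m_1$ decoupled cells, $2\le m_1\le m\le n$, numbered so that they are the $m_1$ first ones, and satisfying the rank condition. Let a symplectic basis $(X_1,Y_1,\dots,X_n,Y_n,Z)$ of $\mathfrak h^n$ be chosen such that $X_i=B_i$ for $i=1,\dots,m$, the first $m_1$ cells are decoupled, and for $i=1,\dots,m_1$ the restriction of $D$ to $\mathrm{Span}\{B_i,Y_i,Z\}$ has in the basis $(B_i,Y_i,Z)$ the matrix $$\begin{pmatrix}0&b_i&0\\c_i&d&0\\0&f_i&d\end{pmatrix},\qquad c_i\neq0,\qquad c_1=1 .$$ (1) If none of the subsystems $(\Sigma_i)$, $i=1,\dots,m_1$, is controllable, but one of the $c_i$'s is negative, then $(\Sigma)$ is controllable. (2) If $(\Sigma)$ is completely decoupled (that is, $m=n$ and all the cells are decoupled, so $m_1=m=n$) and none of the subsystems $(\Sigma_i)$, $i=1,\dots,n$, is controllable, then $(\Sigma)$ is controllable if and only if one of the $c_i$'s is negative.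
   Context: $\mathbb{H}^n$ is the $(2n+1)$-dimensional simply connected Lie group of real $(n+2)\times(n+2)$ upper triangular matrices with ones on the diagonal, first row $(1,y_1,\dots,y_n,z)$, last column $(z,x_1,\dots,x_n,1)^T$, and all other off-diagonal entries $0$. Its Lie algebra $\mathfrak h^n$ (the right-invariant vector fields) has basis $X_i=\partial/\partial x_i$, $Y_i=\partial/\partial y_i+x_i\,\partial/\partial z$ $(1\le i\le n)$, $Z=\partial/\partial z$, with $[X_i,Y_i]=Z$ and all other brackets zero. A basis $(X_1,Y_1,\dots,X_n,Y_n,Z)$ of $\mathfrak h^n$ (with $Z$ any generator of the center) is symplectic if $[X_i,Y_i]=Z$ for all $i$ and all other brackets of basis elements vanish. The columns of the matrix of an endomorphism are the coordinates of the images of the basis vectors. A vector field $\mathcal X$ on a connected Lie group $G$ is linear if its flow is a one-parameter group of automorphisms of $G$; the associated derivation of the Lie algebra $\mathfrak g$ (of right-invariant vector fields) is $D=-\mathrm{ad}(\mathcal X)$. A linear system is a control system $\dot g=\mathcal X(g)+\sum_{j=1}^m u_jB_j(g)$ with $\mathcal X$ linear, the $B_j$ right-invariant, and inputs $u=(u_1,\dots,u_m)$ measurable, locally bounded, with values in $\mathbb R^m$. It is controllable if for all $g,h\in G$ some input steers $g$ to $h$ in some time $T\ge 0$. It satisfies the rank condition if the Lie subalgebra of $\mathfrak g$ generated by $\{D^kB_j:\ k\in\mathbb N,\ 1\le j\le m\}$ is equal to $\mathfrak g$. Given a symplectic basis with $X_i=B_i$ for $i\le m$, the $j$-th cell ($j\le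 m$) is the subspace $\mathrm{Span}\{B_j,Y_j\}$; it is decoupled if $\mathrm{Span}\{B_j,Y_j,Z\}$ is invariant by $D$. In that case $G_j$ denotes the connected Lie subgroup of $\mathbb H^n$ with Lie algebra $\mathrm{Span}\{B_j,Y_j,Z\}$ (invariant under the flow of $\mathcal X$), and $(\Sigma_j)$ denotes the restriction of $(\Sigma)$ to $G_j$, i.e. the one-input linear system $\dot g=\mathcal X(g)+u_jB_j(g)$ on $G_j$. *)

theory Defs
  imports "HOL-Analysis.Analysis" "HOL-Algebra.Generated_Groups"
begin

text \<open>A group element is given by its global coordinates \<open>(x, y, z)\<close>, with \<open>n = CARD('n)\<close>; the
  lemma \<open>heis_matrix_mult\<close> below shows that the group law is multiplication of the matrices with
  first row \<open>(1, y, z)\<close> and last column \<open>(z, x, 1)\<close>. The product type supplies the tangent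
  spaces; its own addition is \<^emph>\<open>not\<close> the group law, although \<open>0\<close> is the identity.\<close>

type_synonym 'n heis = "(real ^ 'n) \<times> (real ^ 'n) \<times> real"

definition heis_mult :: "'n::finite heis \<Rightarrow> 'n heis \<Rightarrow> 'n heis" where
  "heis_mult = (\<lambda>(x, y, z) (x', y', z'). (x + x', y + y', z + z' + y \<bullet> x'))"

definition heis_group :: "'n::finite heis monoid" where
  "heis_group = \<lparr>carrier = UNIV, mult = heis_mult, one = 0\<rparr>"

text \<open>In the matrices, \<open>None\<close> is the first index and \<open>Some None\<close> the last one.\<close>

definition heis_matrix :: "'n::finite heis \<Rightarrow> real ^ 'n option option ^ 'n option option" where
  "heis_matrix = (\<lambda>(x, y, z). \<chi> r s.
     case r of
       None \<Rightarrow> (case s of None \<Rightarrow> 1 | Some None \<Rightarrow> z | Some (Some j) \<Rightarrow> y $ j)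
     | Some (Some i) \<Rightarrow>
         (case s of None \<Rightarrow> 0 | Some None \<Rightarrow> x $ i | Some (Some j) \<Rightarrow> if i = j then 1 else 0)
     | Some None \<Rightarrow> (if s = Some None then 1 else 0))"

lemma inj_heis_matrix: "inj heis_matrix"
proof (rule injI)
  fix g h :: "'n::finite heis"
  assume eq: "heis_matrix g = heis_matrix h"
  obtain x y z where g: "g = (x, y, z)" by (cases g)
  obtain x' y' z' where h: "h = (x', y', z')" by (cases h)
  have "heis_matrix g $ r $ s = heis_matrix h $ r $ s" for r s
    using eq by simp
  from this[of None "Some None"] this[of None "Some (Some _)"] this[of "Some (Some _)" "Some None"]
  show "g = h" by (simp add: g h heis_matrix_def vec_eq_iff)
qed

lemma sum_option_UNIV: "(\<Sum>k\<in>UNIV. F k) = F None + (\<Sum>k\<in>UNIV. F (Some k))"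
  for F :: "'a::finite option \<Rightarrow> real"
  by (simp add: UNIV_option_conv sum.reindex)

lemma heis_matrix_mult: "heis_matrix (heis_mult g h) = heis_matrix g ** heis_matrix h"
  by (cases g; cases h)
     (auto simp: heis_matrix_def heis_mult_def vec_eq_iff matrix_matrix_mult_def sum_option_UNIV
       inner_vec_def if_distrib if_distribR sum.delta algebra_simps split: option.split cong: if_cong)

lemma heis_matrix_0: "heis_matrix 0 = mat 1"
  by (auto simp: heis_matrix_def mat_def vec_eq_iff zero_prod_def split: option.split)

lemma group_heis_group: "group heis_group"
proof (rule groupI)
  fix g :: "'n::finite heis"
  obtain x y z where g: "g = (x, y, z)" by (cases g)
  show "\<exists>h\<in>carrier heis_group. h \<otimes>\<^bsub>heis_group\<^esub> g = \<one>\<^bsub>heis_group\<^esub>"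
    by (rule bexI[of _ "(- x, - y, y \<bullet> x - z)"])
       (simp_all add: g heis_group_def heis_mult_def zero_prod_def)
qed (auto simp: heis_group_def heis_mult_def zero_prod_def inner_add_left inner_add_right)

definition vf_bracket :: "('a \<Rightarrow> 'a) \<Rightarrow> ('a \<Rightarrow> 'a) \<Rightarrow> 'a \<Rightarrow> 'a::real_normed_vector" where
  "vf_bracket V W g = frechet_derivative W (at g) (V g) - frechet_derivative V (at g) (W g)"

definition right_invariant :: "('n::finite heis \<Rightarrow> 'n heis) \<Rightarrow> bool" where
  "right_invariant V \<longleftrightarrow>
     (\<forall>h g. V (heis_mult h g) = frechet_derivative (\<lambda>k. heis_mult k g) (at h) (V h))"

text \<open>A right-invariant vector field is identified with its value \<open>\<xi>\<close> at the identity, so that the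
  Lie algebra is the real vector space \<open>'n heis\<close>, with the bracket of vector fields. The lemmas
  \<open>right_invariant_iff\<close>, \<open>vf_bracket_rinv\<close> and \<open>vf_bracket_linear_field\<close> below justify this.\<close>

definition rinv :: "'n::finite heis \<Rightarrow> 'n heis \<Rightarrow> 'n heis" where
  "rinv \<xi> g = frechet_derivative (\<lambda>k. heis_mult k g) (at 0) \<xi>"

definition lie :: "'n::finite heis \<Rightarrow> 'n heis \<Rightarrow> 'n heis" where
  "lie \<xi> \<eta> = vf_bracket (rinv \<xi>) (rinv \<eta>) 0"

definition lie_center :: "'n::finite heis set" where
  "lie_center = {\<zeta>. \<forall>\<xi>. lie \<zeta> \<xi> = 0}"

definition lie_subalgebra :: "'n::finite heis set \<Rightarrow> bool" where
  "lie_subalgebra L \<longleftrightarrow> subspace L \<and> (\<forall>\<xi>\<in>L. \<forall>\<eta>\<in>L. lie \<xi> \<eta> \<in> L)"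

text \<open>The connected Lie subgroup with Lie algebra \<open>L\<close> is generated by the exponentials of \<open>L\<close>,
  i.e. by the integral curves through the identity of the fields in \<open>L\<close>.\<close>

definition lie_subgroup :: "'n::finite heis set \<Rightarrow> 'n heis set" where
  "lie_subgroup L = generate heis_group
     {\<gamma> t | \<gamma> t. \<exists>\<xi>\<in>L. \<gamma> 0 = 0 \<and> (\<forall>s. (\<gamma> has_vector_derivative rinv \<xi> (\<gamma> s)) (at s))}"

lemma heis_mult_has_derivative_left:
  "((\<lambda>k. heis_mult k g) has_derivative (\<lambda>\<xi>. (fst \<xi>, fst (snd \<xi>), snd (snd \<xi>) + fst (snd \<xi>) \<bullet> fst g)))
     (at h)"
  unfolding heis_mult_def case_prod_beta by (auto intro!: derivative_eq_intros)

lemma heis_mult_has_derivative_right: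
  "((\<lambda>k. heis_mult h k) has_derivative (\<lambda>\<xi>. (fst \<xi>, fst (snd \<xi>), snd (snd \<xi>) + fst (snd h) \<bullet> fst \<xi>)))
     (at g)"
  unfolding heis_mult_def case_prod_beta by (auto intro!: derivative_eq_intros)

lemma rinv_eq: "rinv (a, b, c) (x, y, z) = (a, b, c + b \<bullet> x)"
  unfolding rinv_def frechet_derivative_at[OF heis_mult_has_derivative_left, symmetric] by simp

lemma rinv_eq': "rinv \<xi> g = (fst \<xi>, fst (snd \<xi>), snd (snd \<xi>) + fst (snd \<xi>) \<bullet> fst g)"
  by (cases \<xi>; cases g) (simp add: rinv_eq)

lemma rinv_at_0 [simp]: "rinv \<xi> 0 = \<xi>"
  by (simp add: rinv_eq')

lemma right_invariant_iff: "right_invariant V \<longleftrightarrow> (\<exists>\<xi>. V = rinv \<xi>)"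
proof
  assume V: "right_invariant V"
  have "V g = rinv (V 0) g" for g
  proof -
    have "heis_mult 0 g = g"
      by (cases g) (simp add: heis_mult_def zero_prod_def)
    then show ?thesis
      using V[unfolded right_invariant_def, rule_format, of 0 g] by (simp add: rinv_def)
  qed
  then show "\<exists>\<xi>. V = rinv \<xi>" by blast
next
  assume "\<exists>\<xi>. V = rinv \<xi>"
  then show "right_invariant V"
    unfolding right_invariant_def frechet_derivative_at[OF heis_mult_has_derivative_left, symmetric]
    by (auto simp: rinv_eq' heis_mult_def inner_add_right)
qed

lemma rinv_has_derivative:
  "(rinv \<xi> has_derivative (\<lambda>v. (0, 0, fst (snd \<xi>) \<bullet> fst v))) (at g)"
  unfolding rinv_eq'[abs_def] by (auto intro!: derivative_eq_intros)

lemma vf_bracket_rinv: "vf_bracket (rinv \<xi>) (rinv \<eta>) = rinv (lie \<xi> \<eta>)"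
  unfolding lie_def vf_bracket_def frechet_derivative_at[OF rinv_has_derivative, symmetric]
  by (auto simp: rinv_eq' fun_eq_iff)

lemma lie_eq: "lie (a, b, c) (a', b', c') = (0, 0, b' \<bullet> a - b \<bullet> a')"
  unfolding lie_def vf_bracket_def frechet_derivative_at[OF rinv_has_derivative, symmetric]
  by (auto simp: rinv_eq')

primrec cont_diff :: "nat \<Rightarrow> ('a::euclidean_space \<Rightarrow> 'b::real_normed_vector) \<Rightarrow> bool" where
  "cont_diff 0 f \<longleftrightarrow> continuous_on UNIV f"
| "cont_diff (Suc k) f \<longleftrightarrow>
     (\<forall>x. f differentiable (at x)) \<and> (\<forall>v. cont_diff k (\<lambda>x. frechet_derivative f (at x) v))"

definition smooth :: "('a::euclidean_space \<Rightarrow> 'b::real_normed_vector) \<Rightarrow> bool" where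
  "smooth f \<longleftrightarrow> (\<forall>k. cont_diff k f)"

text \<open>The inverse of \<open>\<phi> t\<close> is \<open>\<phi> (- t)\<close>, so each \<open>\<phi> t\<close> is an automorphism of Lie groups.\<close>

definition linear_field :: "('n::finite heis \<Rightarrow> 'n heis) \<Rightarrow> bool" where
  "linear_field \<X> \<longleftrightarrow> smooth \<X> \<and>
     (\<exists>\<phi>. (\<forall>t. \<phi> t \<in> iso heis_group heis_group \<and> smooth (\<phi> t)) \<and>
          \<phi> 0 = id \<and> (\<forall>s t. \<phi> (s + t) = \<phi> s \<circ> \<phi> t) \<and>
          (\<forall>g t. ((\<lambda>t. \<phi> t g) has_vector_derivative \<X> (\<phi> t g)) (at t)))"

definition derivation :: "('n::finite heis \<Rightarrow> 'n heis) \<Rightarrow> 'n heis \<Rightarrow> 'n heis" where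
  "derivation \<X> \<xi> = - vf_bracket \<X> (rinv \<xi>) 0"

lemma linear_field_mult:
  fixes \<X> :: "'n::finite heis \<Rightarrow> 'n heis"
  assumes "linear_field \<X>"
  shows "\<X> (heis_mult h g) =
    (fst (\<X> h) + fst (\<X> g), fst (snd (\<X> h)) + fst (snd (\<X> g)),
     snd (snd (\<X> h)) + snd (snd (\<X> g)) + fst (snd (\<X> h)) \<bullet> fst g + fst (snd h) \<bullet> fst (\<X> g))"
proof -
  obtain \<phi> where \<phi>: "\<And>t. \<phi> t \<in> iso heis_group heis_group" "\<phi> 0 = id"
    and d: "\<And>g t. ((\<lambda>t. \<phi> t g) has_vector_derivative \<X> (\<phi> t g)) (at t)"
    using assms unfolding linear_field_def by blast
  have hom: "\<phi> t (heis_mult h g) = heis_mult (\<phi> t h) (\<phi> t g)" for t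
    using \<phi>(1)[of t] by (simp add: iso_def hom_def heis_group_def del: split_paired_All)
  have dx: "((\<lambda>t. \<phi> t g) has_derivative (\<lambda>s. s *\<^sub>R \<X> g)) (at 0)" for g
    using d[of g 0] \<phi>(2) by (simp add: has_vector_derivative_def)
  have "((\<lambda>t. heis_mult (\<phi> t h) (\<phi> t g)) has_derivative (\<lambda>s. s *\<^sub>R
    (fst (\<X> h) + fst (\<X> g), fst (snd (\<X> h)) + fst (snd (\<X> g)),
     snd (snd (\<X> h)) + snd (snd (\<X> g)) + fst (snd (\<X> h)) \<bullet> fst g + fst (snd h) \<bullet> fst (\<X> g)))) (at 0)"
    unfolding heis_mult_def case_prod_beta
    by (auto intro!: derivative_eq_intros dx simp: \<phi>(2) fun_eq_iff algebra_simps)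
  from vector_derivative_unique_at[OF _ this[folded has_vector_derivative_def]]
  show ?thesis
    using d[of "heis_mult h g" 0] by (simp add: hom \<phi>(2))
qed

lemma vf_bracket_linear_field:
  fixes \<X> :: "'n::finite heis \<Rightarrow> 'n heis"
  assumes "linear_field \<X>"
  shows "(\<lambda>g. - vf_bracket \<X> (rinv \<xi>) g) = rinv (derivation \<X> \<xi>)"
proof
  fix g :: "'n heis"
  have diff: "\<X> differentiable (at g)" for g
  proof -
    have "cont_diff (Suc 0) \<X>"
      using assms unfolding linear_field_def smooth_def by blast
    then show ?thesis by (simp del: split_paired_All)
  qed
  define D where "D g = frechet_derivative \<X> (at g)" for g
  have D: "(\<X> has_derivative D g) (at g)" for g
    unfolding D_def using diff frechet_derivative_works by blast
  have X0: "\<X> 0 = 0"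
    using linear_field_mult[OF assms, of 0 0]
    by (auto simp: heis_mult_def zero_prod_def prod_eq_iff)
  have g0: "heis_mult 0 g = g"
    by (cases g) (simp add: heis_mult_def zero_prod_def)
  have 1: "((\<lambda>k. \<X> (heis_mult k g)) has_derivative (\<lambda>\<xi>. D g (rinv \<xi> g))) (at 0)"
  proof -
    have D': "(\<X> has_derivative D g) (at (heis_mult 0 g))"
      using D by (simp add: g0)
    show ?thesis
      using diff_chain_at[OF heis_mult_has_derivative_left[of g 0] D']
      by (simp add: rinv_eq' o_def)
  qed
  have 2: "((\<lambda>k. \<X> (heis_mult k g)) has_derivative (\<lambda>\<xi>. (fst (D 0 \<xi>), fst (snd (D 0 \<xi>)),
      snd (snd (D 0 \<xi>)) + fst (snd (D 0 \<xi>)) \<bullet> fst g + fst (snd \<xi>) \<bullet> fst (\<X> g)))) (at 0)"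
    unfolding linear_field_mult[OF assms]
    by (auto intro!: derivative_eq_intros D simp: fun_eq_iff)
  have "D g (rinv \<xi> g) = (fst (D 0 \<xi>), fst (snd (D 0 \<xi>)),
      snd (snd (D 0 \<xi>)) + fst (snd (D 0 \<xi>)) \<bullet> fst g + fst (snd \<xi>) \<bullet> fst (\<X> g))"
    using fun_cong[OF has_derivative_unique[OF 1 2], of \<xi>] .
  then show "- vf_bracket \<X> (rinv \<xi>) g = rinv (derivation \<X> \<xi>) g"
    unfolding derivation_def vf_bracket_def frechet_derivative_at[OF rinv_has_derivative, symmetric]
    by (simp add: X0 rinv_eq' D_def[symmetric])
qed

definition rank_condition ::
    "('n::finite heis \<Rightarrow> 'n heis) \<Rightarrow> nat set \<Rightarrow> (nat \<Rightarrow> 'n heis) \<Rightarrow> bool" where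
  "rank_condition \<X> J B \<longleftrightarrow>
     lie_subalgebra hull {(derivation \<X> ^^ k) (B j) | k j. j \<in> J} = UNIV"

definition admissible_input :: "nat set \<Rightarrow> (real \<Rightarrow> nat \<Rightarrow> real) \<Rightarrow> bool" where
  "admissible_input J u \<longleftrightarrow>
     (\<forall>j\<in>J. (\<lambda>t. u t j) \<in> borel_measurable lebesgue \<and> (\<forall>a b. bounded ((\<lambda>t. u t j) ` {a..b})))"

text \<open>Solutions are in the sense of Caratheodory (absolutely continuous, satisfying the equation
  almost everywhere), hence the integral form of the equation.\<close>

definition trajectory :: "('n::finite heis \<Rightarrow> 'n heis) \<Rightarrow> nat set \<Rightarrow> (nat \<Rightarrow> 'n heis) \<Rightarrow>
    (real \<Rightarrow> nat \<Rightarrow> real) \<Rightarrow> real \<Rightarrow> (real \<Rightarrow> 'n heis) \<Rightarrow> bool" where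
  "trajectory \<X> J B u T \<gamma> \<longleftrightarrow> continuous_on {0..T} \<gamma> \<and>
     (\<forall>t\<in>{0..T}. ((\<lambda>s. \<X> (\<gamma> s) + (\<Sum>j\<in>J. u s j *\<^sub>R rinv (B j) (\<gamma> s)))
        has_integral \<gamma> t - \<gamma> 0) {0..t})"

text \<open>Controllability of the system with inputs indexed by \<open>J\<close> and state space the subgroup \<open>G\<close>.\<close>

definition controllable :: "'n::finite heis set \<Rightarrow> ('n heis \<Rightarrow> 'n heis) \<Rightarrow> nat set \<Rightarrow>
    (nat \<Rightarrow> 'n heis) \<Rightarrow> bool" where
  "controllable G \<X> J B \<longleftrightarrow>
     (\<forall>g\<in>G. \<forall>h\<in>G. \<exists>T\<ge>0. \<exists>u \<gamma>. admissible_input J u \<and> trajectory \<X> J B u T \<gamma> \<and>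
        \<gamma> ` {0..T} \<subseteq> G \<and> \<gamma> 0 = g \<and> \<gamma> T = h)"

text \<open>The cardinality condition says that the \<open>2 n + 1\<close> basis vectors are distinct.\<close>

definition symplectic_basis ::
    "(nat \<Rightarrow> 'n::finite heis) \<Rightarrow> (nat \<Rightarrow> 'n heis) \<Rightarrow> 'n heis \<Rightarrow> bool" where
  "symplectic_basis X Y Z \<longleftrightarrow>
     (let I = {1..CARD('n)}; S = X ` I \<union> Y ` I \<union> {Z} in
        independent S \<and> span S = UNIV \<and> card S = 2 * CARD('n) + 1 \<and>
        span {Z} = lie_center \<and>
        (\<forall>i\<in>I. \<forall>j\<in>I. lie (X i) (Y j) = (if i = j then Z else 0) \<and>
           lie (X i) (X j) = 0 \<and> lie (Y i) (Y j) = 0) \<and>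
        (\<forall>i\<in>I. lie (X i) Z = 0 \<and> lie (Y i) Z = 0))"

definition decoupled_cell :: "('n::finite heis \<Rightarrow> 'n heis) \<Rightarrow> (nat \<Rightarrow> 'n heis) \<Rightarrow>
    (nat \<Rightarrow> 'n heis) \<Rightarrow> 'n heis \<Rightarrow> nat \<Rightarrow> bool" where
  "decoupled_cell \<X> B Y Z j \<longleftrightarrow>
     derivation \<X> ` span {B j, Y j, Z} \<subseteq> span {B j, Y j, Z}"

definition cell_controllable :: "('n::finite heis \<Rightarrow> 'n heis) \<Rightarrow> (nat \<Rightarrow> 'n heis) \<Rightarrow>
    (nat \<Rightarrow> 'n heis) \<Rightarrow> 'n heis \<Rightarrow> nat \<Rightarrow> bool" where
  "cell_controllable \<X> B Y Z j \<longleftrightarrow> controllable (lie_subgroup (span {B j, Y j, Z})) \<X> {j} B"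

text \<open>Columns are the coordinates of the images: \<open>F (v $ j) = \<Sum>i. A i j v i\<close>.\<close>

definition has_matrix :: "('a::real_vector \<Rightarrow> 'a) \<Rightarrow> 'a ^ 'k \<Rightarrow> real ^ 'k ^ 'k \<Rightarrow> bool" where
  "has_matrix F v A \<longleftrightarrow> (\<forall>j. F (v $ j) = (\<Sum>i\<in>UNIV. A $ i $ j *\<^sub>R v $ i))"

end

theory Submission
  imports Defs
begin

text \<open>In exponential coordinates a linear field becomes its derivation, and the system reads
  \<open>\<xi>' = D \<xi> + \<Sum>j. u\<^sub>j (B\<^sub>j + [\<xi>, B\<^sub>j] / 2)\<close> (lemmas \<open>linear_field_hexp\<close> and \<open>rinv_hexp\<close>). Modulo the
  center it is a linear control system, for which the rank condition is Kalman's condition. So every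
  state can be steered to the center and the center to every state, and controllability is reduced to
  motions along the center (lemma \<open>controllable_if_vertical\<close>).

  In a decoupled cell with coordinates \<open>x, y\<close>, put \<open>z = \<zeta> + x y / 2\<close>, where \<open>\<zeta>\<close> is the coordinate of \<open>Z\<close>.
  Then \<open>x' = b y + u\<close>, \<open>y' = c x + d y\<close> and \<open>z' = d z + b y\<^sup>2 / 2 + f y + c x\<^sup>2 / 2\<close>. The input makes \<open>y\<close> an
  arbitrary loop, and the gain in \<open>e\<^bsup>- d t\<^esup> z\<close> along it is an integral of a quadratic polynomial in \<open>y\<close> and
  \<open>y'\<close> with leading term \<open>y'\<^sup>2 / (2 c)\<close>. Fast loops therefore produce every gain that has the sign of
  \<open>c\<close> (lemma \<open>cell_gains_sign\<close>). If one \<open>c\<^sub>i\<close> is negative, the cell \<open>i\<close> and the first cell, where \<open>c\<^sub>1 = 1\<close>,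
  together move the center in both directions, and the system is controllable.

  A single cell also moves the center against the sign of \<open>c\<close> if \<open>d\<^sup>2 + 4 b c < 0\<close>, since then the
  quadratic form has the opposite sign on slow loops, or if \<open>d = 0\<close> and \<open>f \<noteq> 0\<close>, since then the linear term can
  be made to dominate (lemma \<open>cell_gains_opposite_sign\<close>). Hence a cell that is not controllable satisfies
  \<open>d\<^sup>2 + 4 b c \<ge> 0\<close>, and \<open>d \<noteq> 0\<close> or \<open>f = 0\<close>. If all \<open>c\<^sub>i\<close> are positive, the cells fill the algebra and
  none of them is controllable, then completing the square in each cell yields a function \<open>V\<close>, equal
  to \<open>z\<close> minus a quadratic polynomial in the \<open>y\<^sub>i\<close>, with \<open>V' \<ge> d V\<close> along all trajectories
  (lemma \<open>not_controllable_decoupled\<close>). The region \<open>V \<ge> 0\<close> cannot be left, so the system is not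
  controllable.\<close>

section \<open>Exponential coordinates\<close>

text \<open>The exponential map of the group and its inverse, with the derivatives of both. In these
  coordinates automorphisms of the group are linear maps, hence linear fields are linear.\<close>

definition hexp :: "'n::finite heis \<Rightarrow> 'n heis" where
  "hexp \<xi> = (fst \<xi>, fst (snd \<xi>), snd (snd \<xi>) + (fst \<xi> \<bullet> fst (snd \<xi>)) / 2)"

definition hlog :: "'n::finite heis \<Rightarrow> 'n heis" where
  "hlog g = (fst g, fst (snd g), snd (snd g) - (fst g \<bullet> fst (snd g)) / 2)"

definition dhexp :: "'n::finite heis \<Rightarrow> 'n heis \<Rightarrow> 'n heis" where
  "dhexp \<xi> \<eta> = (fst \<eta>, fst (snd \<eta>),
     snd (snd \<eta>) + (fst \<eta> \<bullet> fst (snd \<xi>) + fst \<xi> \<bullet> fst (snd \<eta>)) / 2)"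

definition dhlog :: "'n::finite heis \<Rightarrow> 'n heis \<Rightarrow> 'n heis" where
  "dhlog g v = (fst v, fst (snd v),
     snd (snd v) - (fst v \<bullet> fst (snd g) + fst g \<bullet> fst (snd v)) / 2)"

lemma hexp_hlog [simp]: "hexp (hlog g) = g" and hlog_hexp [simp]: "hlog (hexp \<xi>) = \<xi>"
  by (simp_all add: hexp_def hlog_def)

lemma hexp_0 [simp]: "hexp 0 = 0"
  by (simp add: hexp_def zero_prod_def)

lemma range_hexp: "hexp ` UNIV = UNIV"
  by (metis hexp_hlog surjI)

lemma dhlog_dhexp [simp]: "dhlog (hexp \<xi>) (dhexp \<xi> \<eta>) = \<eta>"
  by (simp add: dhlog_def dhexp_def hexp_def)

lemma hexp_has_derivative: "(hexp has_derivative dhexp \<xi>) (at \<xi> within S)"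
  unfolding hexp_def dhexp_def by (auto intro!: derivative_eq_intros simp: fun_eq_iff)

lemma hlog_has_derivative: "(hlog has_derivative dhlog g) (at g within S)"
  unfolding hlog_def dhlog_def by (auto intro!: derivative_eq_intros simp: fun_eq_iff)

lemma lie_eq': "lie \<xi> \<eta> = (0, 0, fst (snd \<eta>) \<bullet> fst \<xi> - fst (snd \<xi>) \<bullet> fst \<eta>)"
  by (cases \<xi>; cases \<eta>) (simp add: lie_eq)

lemma linear_lie_left: "linear (\<lambda>\<xi>. lie \<xi> \<eta>)"
  by (auto intro!: linearI simp: lie_eq' algebra_simps inner_add_left inner_add_right)

lemma lie_self [simp]: "lie \<xi> \<xi> = 0"
  by (simp add: lie_eq' inner_commute zero_prod_def)

lemma lie_antisym: "lie \<eta> \<xi> = - lie \<xi> \<eta>"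
  by (simp add: lie_eq' inner_commute)

lemma rinv_hexp: "rinv \<xi> (hexp \<eta>) = dhexp \<eta> (\<xi> + (1/2) *\<^sub>R lie \<eta> \<xi>)"
  by (simp add: rinv_eq' hexp_def dhexp_def lie_eq' inner_commute field_simps)

lemma linear_dhexp: "linear (dhexp \<xi>)"
  by (auto intro!: linearI simp: dhexp_def algebra_simps inner_add_left inner_add_right
      add_divide_distrib diff_divide_distrib)

section \<open>Linear fields in exponential coordinates\<close>

lemma linear_field_has_derivative:
  assumes "linear_field \<X>"
  shows "(\<X> has_derivative frechet_derivative \<X> (at g)) (at g)"
proof -
  have "cont_diff (Suc 0) \<X>"
    using assms unfolding linear_field_def smooth_def by blast
  then have "\<X> differentiable (at g)" by (simp del: split_paired_All)
  then show ?thesis using frechet_derivative_works by blast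
qed

lemma linear_field_continuous_on: "linear_field \<X> \<Longrightarrow> continuous_on S \<X>"
  by (meson continuous_at_imp_continuous_on has_derivative_continuous linear_field_has_derivative)

lemma linear_field_0: "linear_field \<X> \<Longrightarrow> \<X> 0 = 0"
  using linear_field_mult[of \<X> 0 0] by (auto simp: heis_mult_def zero_prod_def prod_eq_iff)

lemma vf_bracket_linear_rinv:
  "vf_bracket \<X> (rinv \<xi>) g = (0, 0, fst (snd \<xi>) \<bullet> fst (\<X> g)) - frechet_derivative \<X> (at g) (rinv \<xi> g)"
  unfolding vf_bracket_def frechet_derivative_at[OF rinv_has_derivative, symmetric] by simp

lemma derivation_eq:
  assumes "linear_field \<X>"
  shows "derivation \<X> = frechet_derivative \<X> (at 0)"
  unfolding derivation_def vf_bracket_linear_rinv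
  by (simp add: linear_field_0[OF assms] fun_eq_iff flip: zero_prod_def)

lemma linear_derivation: "linear_field \<X> \<Longrightarrow> linear (derivation \<X>)"
  using linear_field_has_derivative[of \<X> 0] has_derivative_linear derivation_eq by metis

text \<open>The bracket of a linear field with a right-invariant field is again right-invariant; read at
  \<open>g\<close>, this determines the derivative of \<open>\<X>\<close> at \<open>g\<close> from its derivative at the identity.\<close>

lemma linear_field_derivative_rinv:
  assumes "linear_field \<X>"
  shows "frechet_derivative \<X> (at g) (rinv \<xi> g) =
    rinv (derivation \<X> \<xi>) g + (0, 0, fst (snd \<xi>) \<bullet> fst (\<X> g))"
  using fun_cong[OF vf_bracket_linear_field[OF assms], of \<xi> g]
  unfolding vf_bracket_linear_rinv by (auto simp: algebra_simps)

lemma hexp_ray: "((\<lambda>s. hexp (s *\<^sub>R \<xi>)) has_vector_derivative rinv \<xi> (hexp (s *\<^sub>R \<xi>))) (at s)"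
proof -
  have "((\<lambda>s. s *\<^sub>R \<xi>) has_vector_derivative \<xi>) (at s)"
    by (auto intro!: derivative_eq_intros)
  from vector_derivative_diff_chain_within[OF this hexp_has_derivative]
  have "((\<lambda>s. hexp (s *\<^sub>R \<xi>)) has_vector_derivative dhexp (s *\<^sub>R \<xi>) \<xi>) (at s)"
    by (simp add: o_def)
  then show ?thesis
    by (simp add: rinv_hexp linear_scale[OF linear_lie_left])
qed

lemma has_vector_derivative_zero_UNIV:
  fixes f :: "real \<Rightarrow> 'a::real_normed_vector"
  assumes "\<And>s. (f has_vector_derivative 0) (at s)"
  shows "f s = f 0"
proof -
  obtain c where "\<And>x. x \<in> UNIV \<Longrightarrow> f x = c"
    using has_vector_derivative_zero_constant[of UNIV f] assms by auto
  then show ?thesis by simp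
qed

text \<open>Along the one-parameter group \<open>s \<mapsto> hexp (s \<xi>)\<close> the previous lemma is a differential equation
  for \<open>\<X>\<close>, whose right-hand side involves \<open>\<X>\<close> only through its \<open>x\<close>-component. So the
  \<open>x\<close>-component is found first, and the \<open>z\<close>-component by a second integration.\<close>

lemma linear_field_hexp:
  fixes \<X> :: "'n::finite heis \<Rightarrow> 'n heis"
  assumes \<X>: "linear_field \<X>"
  shows "\<X> (hexp \<xi>) = dhexp \<xi> (derivation \<X> \<xi>)"
proof -
  define \<eta> where "\<eta> = derivation \<X> \<xi>"
  define g where "g s = hexp (s *\<^sub>R \<xi>)" for s :: real
  define G where "G s = dhexp (s *\<^sub>R \<xi>) (s *\<^sub>R \<eta>)" for s :: real
  have d1: "((\<lambda>s. \<X> (g s)) has_vector_derivative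
      rinv \<eta> (g s) + (0, 0, fst (snd \<xi>) \<bullet> fst (\<X> (g s)))) (at s)" for s
    using vector_derivative_diff_chain_within[OF hexp_ray[of \<xi> s]
        has_derivative_at_withinI[OF linear_field_has_derivative[OF \<X>]]]
    unfolding linear_field_derivative_rinv[OF \<X>] g_def \<eta>_def o_def by simp
  have d2: "(G has_vector_derivative (fst \<eta>, fst (snd \<eta>),
      snd (snd \<eta>) + s * (fst \<eta> \<bullet> fst (snd \<xi>) + fst \<xi> \<bullet> fst (snd \<eta>)))) (at s)" for s
    unfolding G_def dhexp_def has_vector_derivative_def
    by (auto intro!: derivative_eq_intros simp: fun_eq_iff algebra_simps)
  have "fst (\<X> (g s)) - s *\<^sub>R fst \<eta> = fst (\<X> (g 0)) - 0 *\<^sub>R fst \<eta>" for s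
  proof (rule has_vector_derivative_zero_UNIV[where s = s])
    fix s
    show "((\<lambda>s. fst (\<X> (g s)) - s *\<^sub>R fst \<eta>) has_vector_derivative 0) (at s)"
      using d1[of s] unfolding has_vector_derivative_def
      by (auto intro!: derivative_eq_intros simp: rinv_eq' fun_eq_iff algebra_simps)
  qed
  then have fst_X: "fst (\<X> (g s)) = s *\<^sub>R fst \<eta>" for s
    by (simp add: g_def linear_field_0[OF \<X>])
  have "\<X> (g 1) - G 1 = \<X> (g 0) - G 0"
  proof (rule has_vector_derivative_zero_UNIV)
    fix s
    have "rinv \<eta> (g s) + (0, 0, fst (snd \<xi>) \<bullet> fst (\<X> (g s))) = (fst \<eta>, fst (snd \<eta>),
      snd (snd \<eta>) + s * (fst \<eta> \<bullet> fst (snd \<xi>) + fst \<xi> \<bullet> fst (snd \<eta>)))"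
      unfolding fst_X by (simp add: rinv_eq' g_def hexp_def inner_commute algebra_simps)
    then show "((\<lambda>s. \<X> (g s) - G s) has_vector_derivative 0) (at s)"
      using has_vector_derivative_diff[OF d1[of s] d2[of s]] by simp
  qed
  then show ?thesis
    by (simp add: g_def G_def linear_field_0[OF \<X>] \<eta>_def dhexp_def flip: zero_prod_def)
qed

section \<open>Concatenation and construction of trajectories\<close>

text \<open>Inputs are Borel here: Borel functions are stable under translation of time, so that trajectories
  can be concatenated, and every Borel function is Lebesgue measurable.\<close>

definition steers :: "'n::finite heis set \<Rightarrow> ('n heis \<Rightarrow> 'n heis) \<Rightarrow> nat set \<Rightarrow> (nat \<Rightarrow> 'n heis) \<Rightarrow>
    'n heis \<Rightarrow> 'n heis \<Rightarrow> bool" where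
  "steers G \<X> J B g h \<longleftrightarrow> (\<exists>T\<ge>0. \<exists>u \<gamma>.
     (\<forall>j\<in>J. (\<lambda>t. u t j) \<in> borel_measurable borel \<and> (\<forall>a b. bounded ((\<lambda>t. u t j) ` {a..b}))) \<and>
     trajectory \<X> J B u T \<gamma> \<and> \<gamma> ` {0..T} \<subseteq> G \<and> \<gamma> 0 = g \<and> \<gamma> T = h)"

lemma controllableI:
  assumes "\<And>g h. g \<in> G \<Longrightarrow> h \<in> G \<Longrightarrow> steers G \<X> J B g h"
  shows "controllable G \<X> J B"
  using assms unfolding controllable_def steers_def admissible_input_def
  by (metis measurable_completion measurable_lborel2)

lemma steers_trans:
  assumes "steers G \<X> J B g h" "steers G \<X> J B h k"
  shows "steers G \<X> J B g k"
proof -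
  define F where "F u \<gamma> s = \<X> (\<gamma> s) + (\<Sum>j\<in>J. u s j *\<^sub>R rinv (B j) (\<gamma> s))" for u \<gamma> and s :: real
  obtain T1 u1 \<gamma>1 where 1: "T1 \<ge> 0" 
    "\<And>j. j \<in> J \<Longrightarrow> (\<lambda>t. u1 t j) \<in> borel_measurable borel"
    "\<And>j a b. j \<in> J \<Longrightarrow> bounded ((\<lambda>t. u1 t j) ` {a..b})"
    "continuous_on {0..T1} \<gamma>1" "\<And>t. t \<in> {0..T1} \<Longrightarrow> (F u1 \<gamma>1 has_integral \<gamma>1 t - \<gamma>1 0) {0..t}"
    "\<gamma>1 ` {0..T1} \<subseteq> G" "\<gamma>1 0 = g" "\<gamma>1 T1 = h"
    using assms(1) unfolding steers_def trajectory_def F_def by blast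
  obtain T2 u2 \<gamma>2 where 2: "T2 \<ge> 0" 
    "\<And>j. j \<in> J \<Longrightarrow> (\<lambda>t. u2 t j) \<in> borel_measurable borel"
    "\<And>j a b. j \<in> J \<Longrightarrow> bounded ((\<lambda>t. u2 t j) ` {a..b})"
    "continuous_on {0..T2} \<gamma>2" "\<And>t. t \<in> {0..T2} \<Longrightarrow> (F u2 \<gamma>2 has_integral \<gamma>2 t - \<gamma>2 0) {0..t}"
    "\<gamma>2 ` {0..T2} \<subseteq> G" "\<gamma>2 0 = h" "\<gamma>2 T2 = k"
    using assms(2) unfolding steers_def trajectory_def F_def by blast
  define u where "u t j = (if t \<le> T1 then u1 t j else u2 (t - T1) j)" for t j
  define \<gamma> where "\<gamma> t = (if t \<le> T1 then \<gamma>1 t else \<gamma>2 (t - T1))" for t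
  have meas: "(\<lambda>t. u t j) \<in> borel_measurable borel" if "j \<in> J" for j
  proof -
    have "(\<lambda>t. u2 (t - T1) j) \<in> borel_measurable borel"
      using measurable_compose[OF _ 2(2)[OF that], of "\<lambda>t. t - T1" borel] by simp
    then show ?thesis
      using 1(2)[OF that] unfolding u_def by measurable
  qed
  have bdd: "bounded ((\<lambda>t. u t j) ` {a..b})" if "j \<in> J" for j a b
  proof (rule bounded_subset)
    show "bounded ((\<lambda>t. u1 t j) ` {a..b} \<union> (\<lambda>t. u2 t j) ` {a-T1..b-T1})"
      using 1(3) 2(3) that by simp
    show "(\<lambda>t. u t j) ` {a..b} \<subseteq> (\<lambda>t. u1 t j) ` {a..b} \<union> (\<lambda>t. u2 t j) ` {a-T1..b-T1}"
      by (auto simp: u_def)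
  qed
  have cont: "continuous_on {0..T1+T2} \<gamma>"
  proof -
    have "continuous_on ({0..T1} \<union> {T1..T1+T2}) \<gamma>"
      unfolding \<gamma>_def
    proof (rule continuous_on_If)
      show "continuous_on {T1..T1+T2} (\<lambda>t. \<gamma>2 (t - T1))"
        by (rule continuous_on_compose2[OF 2(4)]) (auto intro!: continuous_intros)
    qed (use 1 2 in auto)
    moreover have "{0..T1} \<union> {T1..T1+T2} = {0..T1+T2}" using 1(1) 2(1) by auto
    ultimately show ?thesis by simp
  qed
  have left: "(F u \<gamma> has_integral \<gamma> t - \<gamma> 0) {0..t}" if t: "t \<in> {0..T1}" for t
  proof (rule has_integral_eq)
    show "(F u1 \<gamma>1 has_integral \<gamma> t - \<gamma> 0) {0..t}"
      using 1(1) 1(5)[of t] t by (simp add: \<gamma>_def)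
    show "F u1 \<gamma>1 s = F u \<gamma> s" if "s \<in> {0..t}" for s
      using that t by (simp add: F_def u_def \<gamma>_def)
  qed
  have int: "(F u \<gamma> has_integral \<gamma> t - \<gamma> 0) {0..t}" if t: "t \<in> {0..T1+T2}" for t
  proof (cases "t \<le> T1")
    case True
    then show ?thesis using left t by simp
  next
    case False
    have "(F u2 \<gamma>2 has_integral \<gamma>2 (t - T1) - \<gamma>2 0) {0..t-T1}"
      using 2(5)[of "t - T1"] t False by simp
    then have "((\<lambda>s. F u2 \<gamma>2 (s - T1)) has_integral \<gamma>2 (t - T1) - \<gamma>2 0) {T1..t}"
      using has_integral_shift_Icc_real[where f = "\<lambda>s. F u2 \<gamma>2 (s - T1)" and c = T1 and a = 0 and b = "t - T1"
          and I = "\<gamma>2 (t - T1) - \<gamma>2 0"]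
      by (simp add: o_def add.commute)
    then have "(F u \<gamma> has_integral \<gamma>2 (t - T1) - \<gamma>2 0) {T1..t}"
      by (rule has_integral_spike_finite[of "{T1}", rotated 2])
         (auto simp: F_def u_def \<gamma>_def)
    with left[of T1] 1(1) False
    have "(F u \<gamma> has_integral (\<gamma> T1 - \<gamma> 0) + (\<gamma>2 (t - T1) - \<gamma>2 0)) {0..t}"
      by (intro has_integral_combine[where c = T1]) auto
    then show ?thesis
      using False 1 2 by (simp add: \<gamma>_def)
  qed
  have "\<gamma> ` {0..T1+T2} \<subseteq> G"
    using 1(6) 2(6) by (force simp: \<gamma>_def)
  moreover have "\<gamma> 0 = g" "\<gamma> (T1 + T2) = k"
    using 1 2 by (auto simp: \<gamma>_def)
  ultimately show ?thesis
    unfolding steers_def trajectory_def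
    using meas bdd cont int 1(1) 2(1)
    by (intro exI[of _ "T1 + T2"] conjI exI[of _ u] exI[of _ \<gamma>]) (auto simp: F_def[abs_def])
qed

text \<open>In exponential coordinates the right-invariant field of \<open>B\<close> is \<open>B + [\<xi>, B] / 2\<close>, so a \<open>C\<^sup>1\<close> curve
  that solves the equation there is mapped to a trajectory.\<close>

lemma steersI_log:
  fixes \<xi> :: "real \<Rightarrow> 'n::finite heis"
  assumes \<X>: "linear_field \<X>" and T: "T \<ge> 0"
    and u: "\<And>j. j \<in> J \<Longrightarrow> continuous_on UNIV (\<lambda>t. u t j)"
    and \<xi>: "\<And>t. t \<in> {0..T} \<Longrightarrow> (\<xi> has_vector_derivative
      derivation \<X> (\<xi> t) + (\<Sum>j\<in>J. u t j *\<^sub>R (B j + (1/2) *\<^sub>R lie (\<xi> t) (B j)))) (at t within {0..T})"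
    and L: "\<And>t. t \<in> {0..T} \<Longrightarrow> \<xi> t \<in> L"
  shows "steers (hexp ` L) \<X> J B (hexp (\<xi> 0)) (hexp (\<xi> T))"
proof -
  define \<gamma> where "\<gamma> t = hexp (\<xi> t)" for t
  define F where "F s = \<X> (\<gamma> s) + (\<Sum>j\<in>J. u s j *\<^sub>R rinv (B j) (\<gamma> s))" for s
  have \<gamma>: "(\<gamma> has_vector_derivative F t) (at t within {0..T})" if "t \<in> {0..T}" for t
  proof -
    have "(\<gamma> has_vector_derivative dhexp (\<xi> t) (derivation \<X> (\<xi> t) +
        (\<Sum>j\<in>J. u t j *\<^sub>R (B j + (1/2) *\<^sub>R lie (\<xi> t) (B j))))) (at t within {0..T})"
      using vector_derivative_diff_chain_within[OF \<xi>[OF that] hexp_has_derivative]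
      by (simp add: o_def \<gamma>_def[abs_def])
    moreover have "dhexp (\<xi> t) (derivation \<X> (\<xi> t) +
        (\<Sum>j\<in>J. u t j *\<^sub>R (B j + (1/2) *\<^sub>R lie (\<xi> t) (B j)))) = F t"
      by (simp only: F_def \<gamma>_def linear_field_hexp[OF \<X>] rinv_hexp linear_add[OF linear_dhexp]
          linear_sum[OF linear_dhexp] linear_scale[OF linear_dhexp] o_def)
    ultimately show ?thesis by simp
  qed
  have cont: "continuous_on {0..T} \<gamma>"
    using \<gamma> has_vector_derivative_continuous continuous_on_eq_continuous_within by blast
  have "(F has_integral \<gamma> t - \<gamma> 0) {0..t}" if t: "t \<in> {0..T}" for t
  proof (rule fundamental_theorem_of_calculus)
    fix s assume "s \<in> {0..t}"
    with t show "(\<gamma> has_vector_derivative F s) (at s within {0..t})"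
      by (intro has_vector_derivative_within_subset[OF \<gamma>]) auto
  qed (use t in auto)
  moreover have "(\<lambda>t. u t j) \<in> borel_measurable borel" if "j \<in> J" for j
    using u[OF that] by (rule borel_measurable_continuous_onI)
  moreover have "bounded ((\<lambda>t. u t j) ` {a..b})" if "j \<in> J" for j and a b :: real
    using compact_continuous_image[OF continuous_on_subset[OF u[OF that], of "{a..b}"]]
    by (simp add: compact_imp_bounded)
  ultimately show ?thesis
    unfolding steers_def trajectory_def using T cont L
    by (intro exI[of _ T] conjI exI[of _ u] exI[of _ \<gamma>]) (auto simp: F_def[abs_def] \<gamma>_def)
qed

section \<open>Connected Lie subgroups\<close>

lemma heis_mult_hexp: "heis_mult (hexp \<xi>) (hexp \<eta>) = hexp (\<xi> + \<eta> - (1/2) *\<^sub>R lie \<xi> \<eta>)"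
  by (simp add: heis_mult_def hexp_def lie_eq' inner_commute inner_add_left inner_add_right field_simps)

lemma heis_inv_hexp: "inv\<^bsub>heis_group\<^esub> (hexp \<xi>) = hexp (- \<xi>)"
proof (rule group.inv_equality[OF group_heis_group])
  have "heis_mult (hexp (- \<xi>)) (hexp \<xi>) = 0"
    unfolding heis_mult_hexp by (simp add: linear_neg[OF linear_lie_left])
  then show "hexp (- \<xi>) \<otimes>\<^bsub>heis_group\<^esub> hexp \<xi> = \<one>\<^bsub>heis_group\<^esub>"
    by (simp add: heis_group_def)
qed (auto simp: heis_group_def)

text \<open>The first components of two integral curves agree, and the field depends on the base point only
  through the first component, so the difference of the curves is constant.\<close>

lemma rinv_integral_curve:
  assumes "\<gamma> 0 = 0" "\<And>s. (\<gamma> has_vector_derivative rinv \<xi> (\<gamma> s)) (at s)"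
  shows "\<gamma> t = hexp (t *\<^sub>R \<xi>)"
proof -
  have d: "((\<lambda>s. \<gamma> s - hexp (s *\<^sub>R \<xi>)) has_vector_derivative
      rinv \<xi> (\<gamma> s) - rinv \<xi> (hexp (s *\<^sub>R \<xi>))) (at s)" for s
    by (intro has_vector_derivative_diff assms hexp_ray)
  have "fst (\<gamma> s - hexp (s *\<^sub>R \<xi>)) = fst (\<gamma> 0 - hexp (0 *\<^sub>R \<xi>))" for s
  proof (rule has_vector_derivative_zero_UNIV[where s = s])
    fix s
    show "((\<lambda>s. fst (\<gamma> s - hexp (s *\<^sub>R \<xi>))) has_vector_derivative 0) (at s)"
      using has_derivative_fst[OF d[of s, unfolded has_vector_derivative_def]]
      by (simp add: has_vector_derivative_def rinv_eq')
  qed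
  then have "fst (\<gamma> s) = fst (hexp (s *\<^sub>R \<xi>))" for s
    using assms(1) by simp
  then have "((\<lambda>s. \<gamma> s - hexp (s *\<^sub>R \<xi>)) has_vector_derivative 0) (at s)" for s
    using d[of s] by (simp add: rinv_eq' flip: zero_prod_def)
  from has_vector_derivative_zero_UNIV[OF this, of t] assms(1)
  show ?thesis by simp
qed

lemma lie_subgroup_eq:
  assumes "lie_subalgebra L"
  shows "lie_subgroup L = hexp ` L"
proof
  have sub: "subspace L" and lie: "\<And>\<xi> \<eta>. \<xi> \<in> L \<Longrightarrow> \<eta> \<in> L \<Longrightarrow> lie \<xi> \<eta> \<in> L"
    using assms unfolding lie_subalgebra_def by blast+
  show "lie_subgroup L \<subseteq> hexp ` L"
  proof
    fix g assume "g \<in> lie_subgroup L"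
    then show "g \<in> hexp ` L" unfolding lie_subgroup_def
    proof (induction rule: generate.induct)
      case one
      have "hexp 0 \<in> hexp ` L" using sub subspace_0 by blast
      then show ?case by (simp add: heis_group_def)
    next
      case (incl h)
      then show ?case using rinv_integral_curve sub subspace_scale by blast
    next
      case (inv h)
      then obtain t \<xi> where "\<xi> \<in> L" "h = hexp (t *\<^sub>R \<xi>)" using rinv_integral_curve by blast
      then show ?case using sub by (auto simp: heis_inv_hexp subspace_scale subspace_neg)
    next
      case (eng h1 h2)
      then obtain \<xi> \<eta> where "\<xi> \<in> L" "\<eta> \<in> L" "h1 = hexp \<xi>" "h2 = hexp \<eta>" by blast
      then have "h1 \<otimes>\<^bsub>heis_group\<^esub> h2 = hexp (\<xi> + \<eta> - (1/2) *\<^sub>R lie \<xi> \<eta>)"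
        by (simp add: heis_group_def heis_mult_hexp)
      then show ?case
        using \<open>\<xi> \<in> L\<close> \<open>\<eta> \<in> L\<close> sub lie by (simp add: subspace_add subspace_diff subspace_scale)
    qed
  qed
  show "hexp ` L \<subseteq> lie_subgroup L"
  proof
    fix g assume "g \<in> hexp ` L"
    then obtain \<xi> where \<xi>: "\<xi> \<in> L" "g = hexp \<xi>" by blast
    have "g \<in> {\<gamma> t | \<gamma> t. \<exists>\<xi>\<in>L. \<gamma> 0 = 0 \<and> (\<forall>s. (\<gamma> has_vector_derivative rinv \<xi> (\<gamma> s)) (at s))}"
      using \<xi> hexp_ray[of \<xi>]
      by (intro CollectI exI[of _ "\<lambda>s. hexp (s *\<^sub>R \<xi>)"] exI[of _ 1] conjI bexI[of _ \<xi>])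
        (simp_all del: split_paired_All split_paired_Ex)
    then show "g \<in> lie_subgroup L"
      unfolding lie_subgroup_def by (rule generate.incl)
  qed
qed

section \<open>Controllability of linear systems by polynomial curves\<close>

text \<open>The states that the linear control system \<open>v' = A v + \<Sum>j\<in>J. u j *\<^sub>R B j\<close> reaches from \<open>0\<close>.\<close>

definition reach_space :: "('a::real_vector \<Rightarrow> 'a) \<Rightarrow> (nat \<Rightarrow> 'a) \<Rightarrow> nat set \<Rightarrow> 'a set" where
  "reach_space A B J = span {(A ^^ k) (B j) | k j. j \<in> J}"

text \<open>The inputs can cancel the forcing term \<open>f\<close>: the forced system has a closed trajectory through \<open>0\<close>
  on \<open>{0..1}\<close>.\<close>

definition absorbs :: "('a::real_normed_vector \<Rightarrow> 'a) \<Rightarrow> (nat \<Rightarrow> 'a) \<Rightarrow> nat set \<Rightarrow> (real \<Rightarrow> 'a) \<Rightarrow> bool"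
  where "absorbs A B J f \<longleftrightarrow> (\<exists>v u.
    (\<forall>t. (v has_vector_derivative A (v t) + (\<Sum>j\<in>J. u t j *\<^sub>R B j) + f t) (at t)) \<and>
    v 0 = 0 \<and> v 1 = 0 \<and> (\<forall>t. v t \<in> reach_space A B J) \<and>
    (\<forall>j\<in>J. continuous_on UNIV (\<lambda>t. u t j)))"

lemma reach_space_invariant:
  assumes "linear A" "v \<in> reach_space A B J"
  shows "A v \<in> reach_space A B J"
proof -
  have "A ` {(A ^^ k) (B j) | k j. j \<in> J} \<subseteq> {(A ^^ k) (B j) | k j. j \<in> J}"
  proof (clarsimp, goal_cases)
    case (1 k j) then show ?case by (intro exI[of _ "Suc k"] exI[of _ j]) simp
  qed
  then show ?thesis
    using assms(2) linear_span_image[OF assms(1)] span_mono unfolding reach_space_def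
    by (metis (no_types, lifting) image_subset_iff subset_eq)
qed

lemma reach_space_invariant_power:
  assumes "linear A" "v \<in> reach_space A B J"
  shows "(A ^^ k) v \<in> reach_space A B J"
  using assms by (induction k) (auto intro: reach_space_invariant)

lemma absorbs_0: "linear A \<Longrightarrow> absorbs A B J (\<lambda>t. 0)"
  unfolding absorbs_def reach_space_def
  by (intro exI[of _ "\<lambda>_. 0"] exI[of _ "\<lambda>_ _. 0"]) (auto simp: linear_0 span_zero)

lemma absorbs_add:
  assumes A: "linear A" and "absorbs A B J f" "absorbs A B J g"
  shows "absorbs A B J (\<lambda>t. f t + g t)"
proof -
  obtain v u where 1: "\<And>t. (v has_vector_derivative A (v t) + (\<Sum>j\<in>J. u t j *\<^sub>R B j) + f t) (at t)"
    "v 0 = 0" "v 1 = 0" "\<And>t. v t \<in> reach_space A B J" "\<And>j. j \<in> J \<Longrightarrow> continuous_on UNIV (\<lambda>t. u t j)"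
    using assms(2) unfolding absorbs_def by blast
  obtain v' u' where 2: "\<And>t. (v' has_vector_derivative A (v' t) + (\<Sum>j\<in>J. u' t j *\<^sub>R B j) + g t) (at t)"
    "v' 0 = 0" "v' 1 = 0" "\<And>t. v' t \<in> reach_space A B J" "\<And>j. j \<in> J \<Longrightarrow> continuous_on UNIV (\<lambda>t. u' t j)"
    using assms(3) unfolding absorbs_def by blast
  show ?thesis unfolding absorbs_def
  proof (intro exI[of _ "\<lambda>t. v t + v' t"] exI[of _ "\<lambda>t j. u t j + u' t j"] conjI allI ballI)
    fix t
    show "((\<lambda>t. v t + v' t) has_vector_derivative
        A (v t + v' t) + (\<Sum>j\<in>J. (u t j + u' t j) *\<^sub>R B j) + (f t + g t)) (at t)"
      using has_vector_derivative_add[OF 1(1)[of t] 2(1)[of t]]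
      by (simp add: linear_add[OF A] scaleR_left_distrib sum.distrib add_ac)
    show "v t + v' t \<in> reach_space A B J"
      using 1(4) 2(4) unfolding reach_space_def by (simp add: span_add)
  qed (use 1 2 in \<open>auto intro: continuous_intros\<close>)
qed

lemma absorbs_sum:
  assumes "linear A" "finite S" "\<And>s. s \<in> S \<Longrightarrow> absorbs A B J (f s)"
  shows "absorbs A B J (\<lambda>t. \<Sum>s\<in>S. f s t)"
  using assms(2,3)
  by (induction S rule: finite_induct) (auto intro: absorbs_add[OF assms(1)] absorbs_0[OF assms(1)])

abbreviation bump :: "real poly" where "bump \<equiv> [:0, 1, -1:]"

lemma pderiv_power_mult: "\<exists>q'. pderiv (p ^ Suc k * q) = p ^ k * q'"
  by (rule exI[of _ "smult (of_nat (Suc k)) (pderiv p) * q + p * pderiv q"])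
    (simp only: pderiv_mult pderiv_power_Suc, simp add: algebra_simps)

text \<open>A forcing term \<open>g(t) A\<^sup>k B\<^sub>j\<close> is traded for \<open>g'(t) A\<^sup>k\<^sup>-\<^sup>1 B\<^sub>j\<close> by the substitution
  \<open>v \<mapsto> v - g(t) A\<^sup>k\<^sup>-\<^sup>1 B\<^sub>j\<close>; after \<open>k\<close> steps it is a term \<open>g\<^sup>(\<^sup>k\<^sup>)(t) B\<^sub>j\<close>, which an input cancels. The endpoints do not
  move if \<open>g\<close> vanishes to order \<open>k\<close> at both ends, i.e. if it is divisible by \<open>(t (1 - t))\<^sup>k\<close>.\<close>

lemma absorbs_generator:
  fixes B :: "nat \<Rightarrow> 'a::real_normed_vector"
  assumes A: "linear A" and J: "finite J" "j \<in> J"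
  shows "absorbs A B J (\<lambda>t. poly (bump ^ k * q) t *\<^sub>R (A ^^ k) (B j))"
proof (induction k arbitrary: q)
  case 0
  show ?case unfolding absorbs_def
  proof (intro exI[of _ "\<lambda>_. 0"] exI[of _ "\<lambda>t i. if i = j then - poly q t else 0"] conjI allI ballI)
    fix t
    have "(\<Sum>i\<in>J. (if i = j then - poly q t else 0) *\<^sub>R B i) = - (poly q t *\<^sub>R B j)"
      using J by (simp add: if_distrib if_distribR sum.delta cong: if_cong)
    then show "((\<lambda>_. 0) has_vector_derivative A 0 +
        (\<Sum>i\<in>J. (if i = j then - poly q t else 0) *\<^sub>R B i) +
        poly (bump ^ 0 * q) t *\<^sub>R (A ^^ 0) (B j)) (at t)"
      by (simp add: linear_0[OF A])
    show "0 \<in> reach_space A B J" by (simp add: reach_space_def span_zero)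
    fix i
    show "continuous_on UNIV (\<lambda>t. if i = j then - poly q t else 0)"
      by (cases "i = j") (auto intro!: continuous_intros)
  qed auto
next
  case (Suc k)
  define p where "p = bump ^ Suc k * q"
  obtain q' where q': "pderiv p = bump ^ k * q'" using pderiv_power_mult p_def by blast
  obtain v u where v: "\<And>t. (v has_vector_derivative A (v t) + (\<Sum>j\<in>J. u t j *\<^sub>R B j) +
      poly (pderiv p) t *\<^sub>R (A ^^ k) (B j)) (at t)"
    "v 0 = 0" "v 1 = 0" "\<And>t. v t \<in> reach_space A B J" "\<And>j. j \<in> J \<Longrightarrow> continuous_on UNIV (\<lambda>t. u t j)"
    using Suc[of q'] unfolding absorbs_def q' by blast
  have mem: "(A ^^ k) (B j) \<in> reach_space A B J"
    unfolding reach_space_def using J by (intro span_base) blast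
  show ?case unfolding absorbs_def p_def[symmetric]
  proof (intro exI[of _ "\<lambda>t. v t - poly p t *\<^sub>R (A ^^ k) (B j)"] exI[of _ u] conjI allI ballI)
    fix t
    have "((\<lambda>t. poly p t *\<^sub>R (A ^^ k) (B j)) has_vector_derivative
        poly (pderiv p) t *\<^sub>R (A ^^ k) (B j)) (at t)"
      using has_vector_derivative_scaleR[OF poly_DERIV has_vector_derivative_const] by simp
    from has_vector_derivative_diff[OF v(1)[of t] this]
    show "((\<lambda>t. v t - poly p t *\<^sub>R (A ^^ k) (B j)) has_vector_derivative
        A (v t - poly p t *\<^sub>R (A ^^ k) (B j)) + (\<Sum>j\<in>J. u t j *\<^sub>R B j) +
        poly p t *\<^sub>R (A ^^ Suc k) (B j)) (at t)"
      by (simp add: linear_diff[OF A] linear_scale[OF A])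
    show "v t - poly p t *\<^sub>R (A ^^ k) (B j) \<in> reach_space A B J"
      using v(4) mem unfolding reach_space_def by (simp add: span_diff span_scale)
  qed (use v(2-5) in \<open>simp_all add: p_def\<close>)
qed

text \<open>Finitely many generators span the space, so one order of vanishing serves all its vectors.\<close>

lemma absorbs_reach_space:
  fixes B :: "nat \<Rightarrow> 'a::euclidean_space"
  assumes A: "linear A" and J: "finite J"
  obtains N where "\<And>w q. w \<in> reach_space A B J \<Longrightarrow> absorbs A B J (\<lambda>t. poly (bump ^ N * q) t *\<^sub>R w)"
proof -
  let ?G = "{(A ^^ k) (B j) | k j. j \<in> J}"
  obtain S where S: "S \<subseteq> ?G" "independent S" "?G \<subseteq> span S"
    by (rule maximal_independent_subset)
  have fin: "finite S" using S(2) independent_imp_finite by blast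
  have "\<forall>s\<in>S. \<exists>k. \<exists>j\<in>J. s = (A ^^ k) (B j)" using S(1) by blast
  then obtain k where k: "\<And>s. s \<in> S \<Longrightarrow> \<exists>j\<in>J. s = (A ^^ k s) (B j)" by metis
  define N where "N = sum k S"
  show ?thesis
  proof
    fix w q assume "w \<in> reach_space A B J"
    then have "w \<in> span S" unfolding reach_space_def using span_minimal[OF S(3)] by auto
    then obtain a where w: "w = (\<Sum>s\<in>S. a s *\<^sub>R s)" using span_finite[OF fin] by auto
    have "absorbs A B J (\<lambda>t. \<Sum>s\<in>S. poly (bump ^ k s * (bump ^ (N - k s) * smult (a s) q)) t *\<^sub>R s)"
    proof (rule absorbs_sum[OF A fin])
      fix s assume "s \<in> S"
      then obtain j where "j \<in> J" "s = (A ^^ k s) (B j)" using k by blast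
      then show "absorbs A B J (\<lambda>t. poly (bump ^ k s * (bump ^ (N - k s) * smult (a s) q)) t *\<^sub>R s)"
        using absorbs_generator[OF A J] by metis
    qed
    moreover have "bump ^ k s * (bump ^ (N - k s) * smult (a s) q) = smult (a s) (bump ^ N * q)"
      if "s \<in> S" for s
    proof -
      have "k s \<le> N" unfolding N_def using that fin by (simp add: member_le_sum)
      then have "bump ^ k s * bump ^ (N - k s) = bump ^ N" by (simp flip: power_add)
      then show ?thesis by (metis mult.assoc mult_smult_right)
    qed
    moreover have "poly (bump ^ N * q) t *\<^sub>R w =
        (\<Sum>s\<in>S. poly (smult (a s) (bump ^ N * q)) t *\<^sub>R s)" for t
      by (simp add: w scaleR_sum_right mult.commute del: poly_mult)
    ultimately show "absorbs A B J (\<lambda>t. poly (bump ^ N * q) t *\<^sub>R w)"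
      by (simp only: cong: sum.cong)
  qed
qed

text \<open>The truncated series for \<open>exp(t A) v0\<close> solves \<open>v' = A v\<close> up to an error that vanishes to order \<open>N\<close>
  at \<open>t = 0\<close>.\<close>

lemma truncated_exponential:
  fixes v0 :: "'a::real_normed_vector"
  assumes A: "linear A"
  shows "((\<lambda>t. \<Sum>l\<le>N. (t ^ l / fact l) *\<^sub>R (A ^^ l) v0) has_vector_derivative
    A (\<Sum>l\<le>N. (t ^ l / fact l) *\<^sub>R (A ^^ l) v0) - (t ^ N / fact N) *\<^sub>R (A ^^ Suc N) v0) (at t)"
proof (induction N)
  case 0
  then show ?case by simp
next
  case (Suc N)
  have "((\<lambda>t. (t ^ Suc N / fact (Suc N)) *\<^sub>R (A ^^ Suc N) v0) has_vector_derivative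
      (t ^ N / fact N) *\<^sub>R (A ^^ Suc N) v0) (at t)"
    using has_vector_derivative_scaleR[OF _ has_vector_derivative_const,
        of "\<lambda>t. t ^ Suc N / fact (Suc N)" "t ^ N / fact N" t UNIV "(A ^^ Suc N) v0"]
    by (auto intro!: derivative_eq_intros simp: divide_simps simp del: power_Suc)
  from has_vector_derivative_add[OF Suc this] show ?case
    by (simp add: linear_add[OF A] linear_scale[OF A])
qed

text \<open>The free motion \<open>exp(t A) v0\<close>, truncated to a polynomial \<open>p\<close>, is switched off by a polynomial factor
  \<open>\<theta>\<close> with \<open>\<theta>(0) = 1\<close> and \<open>\<theta>(1) = 0\<close>. The defect of \<open>\<theta> p\<close> consists of \<open>\<theta>' p\<close> and the truncation
  error times \<open>\<theta>\<close>. With \<open>\<theta> = (1 - t\<^sup>N\<^sup>+\<^sup>1)\<^sup>N\<^sup>+\<^sup>1\<close> both vanish to order \<open>N\<close> at \<open>0\<close> and at \<open>1\<close>, so the inputs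
  can absorb them.\<close>

lemma steer_to_zero:
  fixes B :: "nat \<Rightarrow> 'a::euclidean_space"
  assumes A: "linear A" and J: "finite J" and v0: "v0 \<in> reach_space A B J"
  obtains v u where
    "\<And>t. (v has_vector_derivative A (v t) + (\<Sum>j\<in>J. u t j *\<^sub>R B j)) (at t)"
    "v 0 = v0" "v 1 = 0" "\<And>t. v t \<in> reach_space A B J"
    "\<And>j. j \<in> J \<Longrightarrow> continuous_on UNIV (\<lambda>t. u t j)"
proof -
  obtain N where N: "\<And>w q. w \<in> reach_space A B J \<Longrightarrow> absorbs A B J (\<lambda>t. poly (bump ^ N * q) t *\<^sub>R w)"
    using absorbs_reach_space[OF A J, of B] by blast
  have N': "absorbs A B J (\<lambda>t. poly p t *\<^sub>R w)" if "bump ^ N dvd p" "w \<in> reach_space A B J" for p w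
    using that N by (metis dvd_def)
  define h :: "real poly" where "h = 1 - monom 1 (Suc N)"
  define \<theta> where "\<theta> = h ^ Suc N"
  have "[:-1, 1:] dvd h" by (simp add: h_def flip: poly_eq_0_iff_dvd add: poly_monom)
  then have "[:1, -1:] dvd h"
    using minus_dvd_iff[of "[:-1, 1:]" h] by simp
  moreover have bump: "bump = [:0, 1:] * [:1, -1:]" by simp
  ultimately have dvd: "bump ^ N dvd [:0, 1:] ^ N * h ^ N"
    unfolding bump power_mult_distrib by (intro mult_dvd_mono dvd_refl dvd_power_same)
  have d1: "bump ^ N dvd \<theta> * monom a N" for a
  proof -
    have "\<theta> * monom a N = [:0, 1:] ^ N * h ^ N * smult a h"
      by (simp add: \<theta>_def monom_altdef mult_ac)
    then show ?thesis using dvd by (simp only: dvd_mult2)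
  qed
  have "pderiv h = smult (- real (Suc N)) ([:0, 1:] ^ N)"
    unfolding h_def pderiv_diff pderiv_monom by (simp add: monom_altdef del: of_nat_Suc)
  then have "pderiv \<theta> = [:0, 1:] ^ N * h ^ N * [:- (real (Suc N))\<^sup>2:]"
    unfolding \<theta>_def pderiv_power_Suc
    by (simp add: power2_eq_square mult.commute del: of_nat_Suc power_Suc)
  then have d2: "bump ^ N dvd pderiv \<theta> * r" for r
    using dvd by (metis dvd_mult2)
  define p where "p t = (\<Sum>l\<le>N. (t ^ l / fact l) *\<^sub>R (A ^^ l) v0)" for t :: real
  define E where "E t = (\<Sum>l\<le>N. poly (pderiv \<theta> * monom (1 / fact l) l) t *\<^sub>R (A ^^ l) v0) +
    poly (\<theta> * monom (- 1 / fact N) N) t *\<^sub>R (A ^^ Suc N) v0" for t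
  have "absorbs A B J E" unfolding E_def
    by (intro absorbs_add[OF A] absorbs_sum[OF A] N' d1 d2 reach_space_invariant_power A v0) simp
  then obtain r u where r: "\<And>t. (r has_vector_derivative A (r t) + (\<Sum>j\<in>J. u t j *\<^sub>R B j) + E t) (at t)"
    "r 0 = 0" "r 1 = 0" "\<And>t. r t \<in> reach_space A B J" "\<And>j. j \<in> J \<Longrightarrow> continuous_on UNIV (\<lambda>t. u t j)"
    unfolding absorbs_def by blast
  have E: "E t = poly (pderiv \<theta>) t *\<^sub>R p t - (poly \<theta> t * (t ^ N / fact N)) *\<^sub>R (A ^^ Suc N) v0" for t
    by (simp add: E_def p_def poly_monom scaleR_sum_right)
  have p: "((\<lambda>t. poly \<theta> t *\<^sub>R p t) has_vector_derivative A (poly \<theta> t *\<^sub>R p t) + E t) (at t)" for t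
    using has_vector_derivative_scaleR[OF poly_DERIV[of \<theta> t] truncated_exponential[OF A, of v0 N t]]
    unfolding p_def[symmetric] E linear_scale[OF A] by (simp add: scaleR_diff_right algebra_simps)
  show ?thesis
  proof
    fix t
    show "((\<lambda>t. poly \<theta> t *\<^sub>R p t - r t) has_vector_derivative
      A (poly \<theta> t *\<^sub>R p t - r t) + (\<Sum>j\<in>J. (- u t j) *\<^sub>R B j)) (at t)"
      using has_vector_derivative_diff[OF p[of t] r(1)[of t]]
      by (simp add: linear_diff[OF A] sum_negf algebra_simps)
    have "p t \<in> reach_space A B J" unfolding p_def
      using reach_space_invariant_power[OF A v0] unfolding reach_space_def
      by (intro span_sum span_scale) blast
    then show "poly \<theta> t *\<^sub>R p t - r t \<in> reach_space A B J"
      using r(4) unfolding reach_space_def by (intro span_diff span_scale) auto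
  next
    have "p 0 = v0" unfolding p_def
      by (simp add: sum.atMost_shift)
    then show "poly \<theta> 0 *\<^sub>R p 0 - r 0 = v0"
      using r by (simp add: \<theta>_def h_def poly_monom)
    show "poly \<theta> 1 *\<^sub>R p 1 - r 1 = 0"
      using r by (simp add: \<theta>_def h_def poly_monom)
  qed (use r in \<open>auto intro: continuous_intros\<close>)
qed

text \<open>Time reversal replaces \<open>A\<close> by \<open>- A\<close>, which generates the same space.\<close>

lemma steer_from_zero:
  fixes B :: "nat \<Rightarrow> 'a::euclidean_space"
  assumes A: "linear A" and J: "finite J" and v0: "v0 \<in> reach_space A B J"
  obtains v u where
    "\<And>t. (v has_vector_derivative A (v t) + (\<Sum>j\<in>J. u t j *\<^sub>R B j)) (at t)"
    "v 0 = 0" "v 1 = v0" "\<And>t. v t \<in> reach_space A B J"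
    "\<And>j. j \<in> J \<Longrightarrow> continuous_on UNIV (\<lambda>t. u t j)"
proof -
  define A' where "A' x = - A x" for x
  have A': "linear A'" unfolding A'_def by (rule linear_compose_neg[OF A])
  have pow: "(A' ^^ k) x = (-1) ^ k *\<^sub>R (A ^^ k) x" for k x
    by (induction k) (auto simp: A'_def linear_scale[OF A])
  have eq: "reach_space A' B J = reach_space A B J"
  proof -
    have "(A' ^^ k) (B j) \<in> reach_space A B J" if "j \<in> J" for k j
      unfolding pow reach_space_def using that by (intro span_scale span_base) blast
    moreover have "(A ^^ k) (B j) \<in> reach_space A' B J" if "j \<in> J" for k j
    proof -
      have "(A ^^ k) (B j) = (-1) ^ k *\<^sub>R (A' ^^ k) (B j)"
        unfolding pow by (simp flip: power_mult_distrib)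
      then show ?thesis
        unfolding reach_space_def using that by (metis (mono_tags, lifting) mem_Collect_eq span_base span_scale)
    qed
    ultimately show ?thesis unfolding reach_space_def
      by (intro equalityI span_minimal) auto
  qed
  obtain v u where v: "\<And>t. (v has_vector_derivative A' (v t) + (\<Sum>j\<in>J. u t j *\<^sub>R B j)) (at t)"
    "v 0 = v0" "v 1 = 0" "\<And>t. v t \<in> reach_space A B J"
    "\<And>j. j \<in> J \<Longrightarrow> continuous_on UNIV (\<lambda>t. u t j)"
    using steer_to_zero[OF A' J, of v0 B] v0 unfolding eq by blast
  show ?thesis
  proof
    fix t
    have "((\<lambda>t. 1 - t) has_vector_derivative -1) (at t)" by (auto intro!: derivative_eq_intros)
    from vector_diff_chain_at[OF this v(1)]
    show "((\<lambda>t. v (1 - t)) has_vector_derivative A (v (1 - t)) + (\<Sum>j\<in>J. (- u (1 - t) j) *\<^sub>R B j)) (at t)"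
      by (simp add: o_def A'_def sum_negf)
  next
    fix j assume "j \<in> J"
    show "continuous_on UNIV (\<lambda>t. - u (1 - t) j)"
      by (intro continuous_intros continuous_on_compose2[OF v(5)[OF \<open>j \<in> J\<close>]]) auto
  qed (use v in auto)
qed

section \<open>Systems modulo the center\<close>

lemma scalar_affine_ode:
  fixes r :: "real \<Rightarrow> real"
  assumes r: "continuous_on {0..T} r" and t: "t \<in> {0..T}"
  shows "((\<lambda>t. exp (d * t) * (z0 + integral {0..t} (\<lambda>s. exp (- d * s) * r s))) has_real_derivative
    d * (exp (d * t) * (z0 + integral {0..t} (\<lambda>s. exp (- d * s) * r s))) + r t) (at t within {0..T})"
proof -
  have "((\<lambda>t. integral {0..t} (\<lambda>s. exp (- d * s) * r s)) has_real_derivative exp (- d * t) * r t)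
      (at t within {0..T})"
    by (rule integral_has_real_derivative[OF _ t]) (intro continuous_intros r)
  moreover have "exp (d * t) * (exp (- d * t) * r t) = r t"
    by (simp flip: exp_add mult.assoc)
  ultimately show ?thesis
    by (auto intro!: derivative_eq_intros simp: algebra_simps)
qed

text \<open>Testing the bracket of \<open>(a, b, c)\<close> against \<open>(- b, a, 0)\<close> gives \<open>|a|\<^sup>2 + |b|\<^sup>2 = 0\<close>.\<close>

lemma lie_center_eq:
  assumes "\<zeta> \<in> lie_center"
  shows "\<zeta> = (0, 0, snd (snd \<zeta>))"
proof -
  have "lie \<zeta> (- fst (snd \<zeta>), fst \<zeta>, 0) = 0"
    using assms unfolding lie_center_def by blast
  then have "fst \<zeta> \<bullet> fst \<zeta> + fst (snd \<zeta>) \<bullet> fst (snd \<zeta>) = 0"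
    by (simp add: lie_eq' zero_prod_def)
  then have "fst \<zeta> = 0 \<and> fst (snd \<zeta>) = 0"
    by (simp add: add_nonneg_eq_0_iff)
  then show ?thesis by (simp add: prod_eq_iff)
qed

lemma quadratic_attains:
  fixes K m q :: real
  assumes "K \<noteq> 0" "m\<^sup>2 + K * q \<ge> 0"
  obtains a where "a\<^sup>2 * K + 2 * a * m = q"
proof
  define w where "w = sqrt (m\<^sup>2 + K * q)"
  have w: "w\<^sup>2 = m\<^sup>2 + K * q" using assms(2) by (simp add: w_def)
  have "K * (((w - m) / K)\<^sup>2 * K + 2 * ((w - m) / K) * m) = w\<^sup>2 - m\<^sup>2"
    using assms(1) by (simp add: power2_eq_square field_simps)
  then show "((w - m) / K)\<^sup>2 * K + 2 * ((w - m) / K) * m = q"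
    using assms(1) w by simp
qed

locale heis_system =
  fixes \<X> :: "'n::finite heis \<Rightarrow> 'n heis" and Z :: "'n heis" and d :: real
  assumes linear_field: "linear_field \<X>"
    and Z_nz: "Z \<noteq> 0" and Z_center: "Z \<in> lie_center"
    and D_Z: "derivation \<X> Z = d *\<^sub>R Z"
begin

abbreviation D where "D \<equiv> derivation \<X>"

lemma linear_D: "linear D"
  by (rule linear_derivation[OF linear_field])

lemmas D_simps = linear_add[OF linear_D] linear_diff[OF linear_D] linear_scale[OF linear_D]
  linear_0[OF linear_D] linear_sum[OF linear_D]

lemma lie_Z_left [simp]: "lie Z \<xi> = 0"
  using Z_center unfolding lie_center_def by blast

lemma lie_Z_right [simp]: "lie \<xi> Z = 0"
  using lie_antisym[of \<xi> Z] by simp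

lemma Z_coord_nz: "snd (snd Z) \<noteq> 0"
  using Z_nz lie_center_eq[OF Z_center] by (metis zero_prod_def)

text \<open>The symplectic form on the quotient by the center, normalised by \<open>Z\<close>.\<close>

definition symp :: "'n heis \<Rightarrow> 'n heis \<Rightarrow> real" where
  "symp \<xi> \<eta> = snd (snd (lie \<xi> \<eta>)) / snd (snd Z)"

lemma lie_symp: "lie \<xi> \<eta> = symp \<xi> \<eta> *\<^sub>R Z"
  by (subst lie_center_eq[OF Z_center]) (simp add: symp_def lie_eq' Z_coord_nz)

text \<open>A trajectory that solves the equation only modulo the center is corrected by a multiple \<open>\<zeta>(t) Z\<close>:
  the center acts trivially in the bracket, so \<open>\<zeta>\<close> solves a scalar affine equation, whose final
  value depends bijectively on its initial value.\<close>

lemma steers_lift: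
  fixes v :: "real \<Rightarrow> 'n heis"
  assumes T: "T \<ge> 0"
    and v: "\<And>t. (v has_vector_derivative D (v t) + (\<Sum>j\<in>J. u t j *\<^sub>R B j) + r t *\<^sub>R Z) (at t)"
    and u: "\<And>j. j \<in> J \<Longrightarrow> continuous_on UNIV (\<lambda>t. u t j)" and r: "continuous_on UNIV r"
    and L: "subspace L" "Z \<in> L" "\<And>t. v t \<in> L"
  obtains I where "\<And>\<zeta>. steers (hexp ` L) \<X> J B (hexp (v 0 + \<zeta> *\<^sub>R Z))
    (hexp (v T + (exp (d * T) * (\<zeta> + I)) *\<^sub>R Z))"
proof
  define \<rho> where "\<rho> t = (\<Sum>j\<in>J. u t j * symp (v t) (B j)) / 2 - r t" for t
  define I where "I t = integral {0..t} (\<lambda>s. exp (- d * s) * \<rho> s)" for t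
  fix \<zeta>0
  define \<zeta> where "\<zeta> t = exp (d * t) * (\<zeta>0 + I t)" for t
  define \<xi> where "\<xi> t = v t + \<zeta> t *\<^sub>R Z" for t
  have contv: "continuous_on UNIV v"
    using v by (meson continuous_at_imp_continuous_on has_vector_derivative_continuous)
  have cont: "continuous_on UNIV \<rho>"
    unfolding \<rho>_def symp_def lie_eq'
    by (intro continuous_intros u r contv) (auto simp: Z_coord_nz)
  have \<zeta>: "(\<zeta> has_real_derivative d * \<zeta> t + \<rho> t) (at t within {0..T})" if "t \<in> {0..T}" for t
    unfolding \<zeta>_def I_def by (rule scalar_affine_ode[OF continuous_on_subset[OF cont] that]) auto
  have "steers (hexp ` L) \<X> J B (hexp (\<xi> 0)) (hexp (\<xi> T))"
  proof (rule steersI_log[OF linear_field T u])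
    fix t assume t: "t \<in> {0..T}"
    have lie: "lie (\<xi> t) (B j) = symp (v t) (B j) *\<^sub>R Z" for j
      unfolding \<xi>_def linear_add[OF linear_lie_left] linear_scale[OF linear_lie_left] lie_Z_left
      by (simp add: lie_symp)
    have "(\<xi> has_vector_derivative (D (v t) + (\<Sum>j\<in>J. u t j *\<^sub>R B j) + r t *\<^sub>R Z) +
        (d * \<zeta> t + \<rho> t) *\<^sub>R Z) (at t within {0..T})"
      unfolding \<xi>_def
      using has_vector_derivative_add[OF has_vector_derivative_at_within[OF v[of t]]
          has_vector_derivative_scaleR[OF \<zeta>[OF t] has_vector_derivative_const[of Z]]] by simp
    moreover have "(D (v t) + (\<Sum>j\<in>J. u t j *\<^sub>R B j) + r t *\<^sub>R Z) + (d * \<zeta> t + \<rho> t) *\<^sub>R Z =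
        D (\<xi> t) + (\<Sum>j\<in>J. u t j *\<^sub>R (B j + (1/2) *\<^sub>R lie (\<xi> t) (B j)))"
      unfolding lie
      by (simp add: \<xi>_def \<rho>_def D_simps D_Z scaleR_add_right sum.distrib scaleR_add_left
          scaleR_diff_left scaleR_sum_left[symmetric] sum_divide_distrib algebra_simps)
    ultimately show "(\<xi> has_vector_derivative
      D (\<xi> t) + (\<Sum>j\<in>J. u t j *\<^sub>R (B j + (1/2) *\<^sub>R lie (\<xi> t) (B j)))) (at t within {0..T})"
      by simp
    show "\<xi> t \<in> L" unfolding \<xi>_def using L by (simp add: subspace_add subspace_scale)
  qed
  then show "steers (hexp ` L) \<X> J B (hexp (v 0 + \<zeta>0 *\<^sub>R Z))
      (hexp (v T + (exp (d * T) * (\<zeta>0 + I T)) *\<^sub>R Z))"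
    by (simp add: \<xi>_def \<zeta>_def I_def)
qed

text \<open>With \<open>Z\<close> as an additional input (number \<open>0\<close>), linear control theory steers every state to the
  center and the center to every state; the fictitious input is then removed by \<open>steers_lift\<close>.\<close>

lemma controllable_if_vertical:
  assumes J: "finite J" "0 \<notin> J" and L: "subspace L" "Z \<in> L"
    and W: "reach_space D (B(0 := Z)) (insert 0 J) = L"
    and vert: "\<And>a b. steers (hexp ` L) \<X> J B (hexp (a *\<^sub>R Z)) (hexp (b *\<^sub>R Z))"
  shows "controllable (hexp ` L) \<X> J B"
proof (rule controllableI)
  fix g h assume "g \<in> hexp ` L" "h \<in> hexp ` L"
  then obtain \<xi> \<eta> where \<xi>: "\<xi> \<in> L" "g = hexp \<xi>" and \<eta>: "\<eta> \<in> L" "h = hexp \<eta>" by blast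
  have fin: "finite (insert 0 J)" using J by simp
  have sum: "(\<Sum>j\<in>insert 0 J. u j *\<^sub>R (B(0 := Z)) j) = (\<Sum>j\<in>J. u j *\<^sub>R B j) + u 0 *\<^sub>R Z" for u :: "nat \<Rightarrow> real"
  proof -
    have "(\<Sum>j\<in>J. u j *\<^sub>R (B(0 := Z)) j) = (\<Sum>j\<in>J. u j *\<^sub>R B j)"
      by (rule sum.cong) (use J in auto)
    then show ?thesis using J by (simp add: add.commute)
  qed
  obtain v u where v: "\<And>t. (v has_vector_derivative D (v t) + (\<Sum>j\<in>insert 0 J. u t j *\<^sub>R (B(0 := Z)) j)) (at t)"
    "v 0 = \<xi>" "v 1 = 0" "\<And>t. v t \<in> L" "\<And>j. j \<in> insert 0 J \<Longrightarrow> continuous_on UNIV (\<lambda>t. u t j)"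
    using steer_to_zero[OF linear_D fin, of \<xi> "B(0 := Z)"] \<xi>(1) unfolding W by blast
  obtain I where I: "\<And>\<zeta>. steers (hexp ` L) \<X> J B (hexp (v 0 + \<zeta> *\<^sub>R Z))
    (hexp (v 1 + (exp (d * 1) * (\<zeta> + I)) *\<^sub>R Z))"
    by (rule steers_lift[where T = 1 and v = v and u = u and J = J and B = B and r = "\<lambda>t. u t 0" and L = L])
      (use v L in \<open>auto simp: sum add_ac simp del: fun_upd_apply\<close>)
  obtain v' u' where v': "\<And>t. (v' has_vector_derivative D (v' t) + (\<Sum>j\<in>insert 0 J. u' t j *\<^sub>R (B(0 := Z)) j)) (at t)"
    "v' 0 = 0" "v' 1 = \<eta>" "\<And>t. v' t \<in> L" "\<And>j. j \<in> insert 0 J \<Longrightarrow> continuous_on UNIV (\<lambda>t. u' t j)"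
    using steer_from_zero[OF linear_D fin, of \<eta> "B(0 := Z)"] \<eta>(1) unfolding W by blast
  obtain I' where I': "\<And>\<zeta>. steers (hexp ` L) \<X> J B (hexp (v' 0 + \<zeta> *\<^sub>R Z))
    (hexp (v' 1 + (exp (d * 1) * (\<zeta> + I')) *\<^sub>R Z))"
    by (rule steers_lift[where T = 1 and v = v' and u = u' and J = J and B = B and r = "\<lambda>t. u' t 0" and L = L])
      (use v' L in \<open>auto simp: sum add_ac simp del: fun_upd_apply\<close>)
  have "steers (hexp ` L) \<X> J B g (hexp ((exp d * I) *\<^sub>R Z))"
    using I[of 0] v \<xi> by simp
  moreover have "steers (hexp ` L) \<X> J B (hexp ((- I') *\<^sub>R Z)) h"
    using I'[of "- I'"] v' \<eta> by simp
  ultimately show "steers (hexp ` L) \<X> J B g h"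
    using vert steers_trans by blast
qed

section \<open>Motion along the center by loops in a cell\<close>

text \<open>In the coordinates \<open>x, y\<close> of the cell and \<open>z = \<zeta> + x y / 2\<close>, the input enters only
  \<open>x' = b y + u\<close>, while \<open>y' = c x + d y\<close> and \<open>z' = d z + b y\<^sup>2 / 2 + f y + c x\<^sup>2 / 2\<close>. So \<open>x\<close> can be chosen
  freely, and \<open>I\<close> is what a loop in the \<open>(x, y)\<close>-plane adds to \<open>z\<close>.\<close>

lemma cell_loop:
  assumes T: "T \<ge> 0" and J: "finite J" "i \<in> J"
    and L: "subspace L" "B i \<in> L" "Y \<in> L" "Z \<in> L"
    and c: "D (B i) = c *\<^sub>R Y" and bdf: "D Y = b *\<^sub>R B i + d *\<^sub>R Y + f *\<^sub>R Z" and lie: "lie (B i) Y = Z"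
    and y: "\<And>t. (y has_real_derivative c * x t + d * y t) (at t)"
    and x: "\<And>t. (x has_real_derivative x' t) (at t)" and x': "continuous_on UNIV x'"
    and ends: "x 0 = 0" "x T = 0" "y 0 = 0" "y T = 0"
    and I: "((\<lambda>s. exp (- d * s) * (b * (y s)\<^sup>2 / 2 + f * y s + c * (x s)\<^sup>2 / 2)) has_integral I) {0..T}"
  shows "steers (hexp ` L) \<X> J B (hexp (z0 *\<^sub>R Z)) (hexp ((exp (d * T) * (z0 + I)) *\<^sub>R Z))"
proof -
  define h where "h s = b * (y s)\<^sup>2 / 2 + f * y s + c * (x s)\<^sup>2 / 2" for s
  define z where "z t = exp (d * t) * (z0 + integral {0..t} (\<lambda>s. exp (- d * s) * h s))" for t
  define \<xi> where "\<xi> t = x t *\<^sub>R B i + y t *\<^sub>R Y + (z t - x t * y t / 2) *\<^sub>R Z" for t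
  define u where "u t j = (if j = i then x' t - b * y t else 0)" for t j
  have cont: "continuous_on S x" "continuous_on S y" for S
    using x y by (meson DERIV_isCont continuous_at_imp_continuous_on)+
  have z: "(z has_real_derivative d * z t + h t) (at t within {0..T})" if "t \<in> {0..T}" for t
    unfolding z_def
    by (rule scalar_affine_ode[OF _ that]) (auto simp: h_def intro!: continuous_intros cont)
  have "steers (hexp ` L) \<X> J B (hexp (\<xi> 0)) (hexp (\<xi> T))"
  proof (rule steersI_log[OF linear_field T])
    show "continuous_on UNIV (\<lambda>t. u t j)" for j
      unfolding u_def by (cases "j = i") (auto intro!: continuous_intros x' cont)
    fix t assume t: "t \<in> {0..T}"
    show "\<xi> t \<in> L" unfolding \<xi>_def using L by (intro subspace_add subspace_scale) auto
    have lie': "lie (\<xi> t) (B i) = - y t *\<^sub>R Z"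
      using lie lie_antisym[of Y "B i"]
      by (simp add: \<xi>_def linear_add[OF linear_lie_left] linear_scale[OF linear_lie_left])
    have "(\<Sum>j\<in>J. u t j *\<^sub>R (B j + (1/2) *\<^sub>R lie (\<xi> t) (B j))) = (x' t - b * y t) *\<^sub>R (B i - (y t / 2) *\<^sub>R Z)"
      using J by (simp add: u_def if_distrib if_distribR sum.delta lie' cong: if_cong)
    then have eq: "D (\<xi> t) + (\<Sum>j\<in>J. u t j *\<^sub>R (B j + (1/2) *\<^sub>R lie (\<xi> t) (B j))) =
       x' t *\<^sub>R B i + (c * x t + d * y t) *\<^sub>R Y +
       ((d * z t + h t) - (x' t * y t + x t * (c * x t + d * y t)) / 2) *\<^sub>R Z"
      by (simp add: \<xi>_def h_def D_simps c bdf D_Z power2_eq_square scaleR_add_left scaleR_add_right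
          scaleR_diff_left scaleR_diff_right add_divide_distrib diff_divide_distrib algebra_simps)
    show "(\<xi> has_vector_derivative D (\<xi> t) + (\<Sum>j\<in>J. u t j *\<^sub>R (B j + (1/2) *\<^sub>R lie (\<xi> t) (B j)))) (at t within {0..T})"
    proof -
      note x = has_field_derivative_at_within[OF x[of t], of "{0..T}"]
        and y = has_field_derivative_at_within[OF y[of t], of "{0..T}"]
      have "((\<lambda>t. z t - x t * y t / 2) has_real_derivative
          (d * z t + h t) - (x' t * y t + x t * (c * x t + d * y t)) / 2) (at t within {0..T})"
        by (auto intro!: derivative_eq_intros x y z[OF t])
      then show ?thesis
        unfolding eq unfolding \<xi>_def
        using has_vector_derivative_add[OF has_vector_derivative_add[OF
              has_vector_derivative_scaleR[OF x has_vector_derivative_const]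
              has_vector_derivative_scaleR[OF y has_vector_derivative_const]]
            has_vector_derivative_scaleR[OF _ has_vector_derivative_const]]
        by fastforce
    qed
  qed
  moreover have "\<xi> 0 = z0 *\<^sub>R Z" "\<xi> T = (exp (d * T) * (z0 + I)) *\<^sub>R Z"
    using I integral_unique[OF I] by (simp_all add: \<xi>_def ends z_def h_def)
  ultimately show ?thesis by simp
qed

text \<open>The loop is \<open>y = a e\<^bsup>d s / 2\<^esup> \<phi>\<close> with \<open>\<phi> = s\<^sup>2 (T - s)\<^sup>2\<close>, which also makes \<open>x = (y' - d y) / c\<close> vanish
  at both ends. The exponential factor cancels the weight \<open>e\<^bsup>- d s\<^esup>\<close> in the quadratic part, which becomes
  the integral of \<open>\<phi>'\<^sup>2 + (d\<^sup>2 + 4 b c) \<phi>\<^sup>2 / 4\<close> because \<open>\<phi> \<phi>'\<close> integrates to \<open>0\<close>. Its sign is that of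
  \<open>48 + (d\<^sup>2 + 4 b c) T\<^sup>2\<close>: positive for fast loops, and for slow ones the sign of the discriminant.\<close>

lemma cell_bump_loop:
  assumes T: "T \<ge> 0" and J: "finite J" "i \<in> J"
    and L: "subspace L" "B i \<in> L" "Y \<in> L" "Z \<in> L"
    and c: "D (B i) = c *\<^sub>R Y" and bdf: "D Y = b *\<^sub>R B i + d *\<^sub>R Y + f *\<^sub>R Z" and lie: "lie (B i) Y = Z"
    and c0: "c \<noteq> 0"
    and m: "((\<lambda>s. exp (- d * s / 2) * (s\<^sup>2 * (T - s)\<^sup>2)) has_integral m) {0..T}"
    and I: "2 * c * I = a\<^sup>2 * (T ^ 7 * (48 + (d\<^sup>2 + 4 * b * c) * T\<^sup>2) / 2520) + 2 * a * (f * c * m)"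
  shows "steers (hexp ` L) \<X> J B (hexp (z0 *\<^sub>R Z)) (hexp ((exp (d * T) * (z0 + I)) *\<^sub>R Z))"
proof -
  define \<phi> where "\<phi> s = s\<^sup>2 * (T - s)\<^sup>2" for s
  define \<phi>' where "\<phi>' s = 2 * s * (T - s) * (T - 2 * s)" for s
  define \<phi>'' where "\<phi>'' s = 2 * T\<^sup>2 - 12 * T * s + 12 * s\<^sup>2" for s
  define y where "y s = a * exp (d * s / 2) * \<phi> s" for s
  define x where "x s = a * exp (d * s / 2) * (\<phi>' s - d / 2 * \<phi> s) / c" for s
  define x' where "x' s = a * exp (d * s / 2) * (\<phi>'' s - d\<^sup>2 / 4 * \<phi> s) / c" for s
  have \<phi>: "(\<phi> has_real_derivative \<phi>' s) (at s)" for s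
    unfolding \<phi>_def \<phi>'_def
    by (auto intro!: derivative_eq_intros simp: power2_eq_square algebra_simps)
  have \<phi>': "(\<phi>' has_real_derivative \<phi>'' s) (at s)" for s
    unfolding \<phi>'_def \<phi>''_def
    by (auto intro!: derivative_eq_intros simp: power2_eq_square algebra_simps)
  define \<Delta> where "\<Delta> = d\<^sup>2 + 4 * b * c"
  define P1 where "P1 s = 4/3 * T^4 * s^3 - 6 * T^3 * s^4 + 52/5 * T\<^sup>2 * s^5 - 8 * T * s^6 + 16/7 * s^7" for s
  define P2 where "P2 s = T^4 * s^5 / 5 - 2/3 * T^3 * s^6 + 6/7 * T\<^sup>2 * s^7 - T * s^8 / 2 + s^9 / 9" for s
  define P where "P s = P1 s - d / 2 * (\<phi> s)\<^sup>2 + \<Delta> / 4 * P2 s" for s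
  have P1: "(P1 has_real_derivative (\<phi>' s)\<^sup>2) (at s)" for s
  proof -
    have "(\<phi>' s)\<^sup>2 = 4 * T^4 * s\<^sup>2 - 24 * T^3 * s^3 + 52 * T\<^sup>2 * s^4 - 48 * T * s^5 + 16 * s^6"
      unfolding \<phi>'_def by algebra
    then show ?thesis unfolding P1_def by (auto intro!: derivative_eq_intros)
  qed
  have P2: "(P2 has_real_derivative (\<phi> s)\<^sup>2) (at s)" for s
  proof -
    have "(\<phi> s)\<^sup>2 = T^4 * s^4 - 4 * T^3 * s^5 + 6 * T\<^sup>2 * s^6 - 4 * T * s^7 + s^8"
      unfolding \<phi>_def by algebra
    then show ?thesis unfolding P2_def by (auto intro!: derivative_eq_intros)
  qed
  have P: "(P has_real_derivative (\<phi>' s - d / 2 * \<phi> s)\<^sup>2 + b * c * (\<phi> s)\<^sup>2) (at s)" for s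
  proof -
    have "(\<phi>' s - d / 2 * \<phi> s)\<^sup>2 + b * c * (\<phi> s)\<^sup>2 =
      (\<phi>' s)\<^sup>2 - d / 2 * (2 * \<phi> s * \<phi>' s) + \<Delta> / 4 * (\<phi> s)\<^sup>2"
      by (simp add: \<Delta>_def power2_eq_square algebra_simps)
    then show ?thesis
      unfolding P_def by (auto intro!: derivative_eq_intros \<phi> P1 P2)
  qed
  have "((\<lambda>s. (\<phi>' s - d / 2 * \<phi> s)\<^sup>2 + b * c * (\<phi> s)\<^sup>2) has_integral P T - P 0) {0..T}"
  proof (rule fundamental_theorem_of_calculus[OF T])
    show "(P has_vector_derivative (\<phi>' s - d / 2 * \<phi> s)\<^sup>2 + b * c * (\<phi> s)\<^sup>2) (at s within {0..T})" for s
      using has_field_derivative_at_within[OF P] by (simp only: has_real_derivative_iff_has_vector_derivative)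
  qed
  also have "P T - P 0 = T ^ 7 * (48 + (d\<^sup>2 + 4 * b * c) * T\<^sup>2) / 2520"
  proof -
    have "P1 T = 2 / 105 * T ^ 7"
    proof -
      have "T^4 * T^3 = T^7" "T^3 * T^4 = T^7" "T\<^sup>2 * T^5 = T^7" "T * T^6 = T^7"
        by algebra+
      then show ?thesis unfolding P1_def mult.assoc by simp
    qed
    moreover have "P2 T = T ^ 7 * T\<^sup>2 / 630"
    proof -
      have "T ^ 7 * T\<^sup>2 = T ^ 9" by algebra
      moreover
      have "T^4 * T^5 = T^9" "T^3 * T^6 = T^9" "T\<^sup>2 * T^7 = T^9" "T * T^8 = T^9"
        by algebra+
      ultimately show ?thesis unfolding P2_def mult.assoc by simp
    qed
    moreover have "P 0 = 0" by (simp add: P_def P1_def P2_def \<phi>_def)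
    moreover have "P T = P1 T + \<Delta> / 4 * P2 T" by (simp add: P_def \<phi>_def)
    ultimately have "P T - P 0 = 2 / 105 * T ^ 7 + \<Delta> / 4 * (T ^ 7 * T\<^sup>2 / 630)" by (simp only: diff_0_right)
    also have "\<dots> = T ^ 7 * (48 + \<Delta> * T\<^sup>2) / 2520" by (simp add: distrib_left)
    finally show ?thesis unfolding \<Delta>_def .
  qed
  finally have quad: "((\<lambda>s. (\<phi>' s - d / 2 * \<phi> s)\<^sup>2 + b * c * (\<phi> s)\<^sup>2) has_integral
      T ^ 7 * (48 + (d\<^sup>2 + 4 * b * c) * T\<^sup>2) / 2520) {0..T}" .
  have "((\<lambda>s. (a\<^sup>2 * ((\<phi>' s - d / 2 * \<phi> s)\<^sup>2 + b * c * (\<phi> s)\<^sup>2) +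
      2 * a * f * c * (exp (- d * s / 2) * \<phi> s)) / (2 * c)) has_integral
    (a\<^sup>2 * (T ^ 7 * (48 + (d\<^sup>2 + 4 * b * c) * T\<^sup>2) / 2520) + 2 * a * f * c * m) / (2 * c)) {0..T}"
    using m by (intro has_integral_divide has_integral_add has_integral_mult_right quad) (simp add: \<phi>_def)
  moreover have "(a\<^sup>2 * (T ^ 7 * (48 + (d\<^sup>2 + 4 * b * c) * T\<^sup>2) / 2520) + 2 * a * f * c * m) / (2 * c) = I"
    using I c0 by (simp add: field_simps)
  moreover have "(a\<^sup>2 * ((\<phi>' s - d / 2 * \<phi> s)\<^sup>2 + b * c * (\<phi> s)\<^sup>2) +
      2 * a * f * c * (exp (- d * s / 2) * \<phi> s)) / (2 * c) =
      exp (- d * s) * (b * (y s)\<^sup>2 / 2 + f * y s + c * (x s)\<^sup>2 / 2)" for s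
  proof -
    define E where "E = exp (d * s / 2)"
    have e: "exp (- d * s) = 1 / E\<^sup>2" "exp (- d * s / 2) = 1 / E" and E: "E \<noteq> 0"
      by (simp_all add: E_def power2_eq_square exp_minus inverse_eq_divide flip: exp_add)
    show ?thesis unfolding e x_def y_def E_def[symmetric] using E c0
      by (simp add: power2_eq_square field_simps)
  qed
  ultimately have int: "((\<lambda>s. exp (- d * s) * (b * (y s)\<^sup>2 / 2 + f * y s + c * (x s)\<^sup>2 / 2)) has_integral I) {0..T}"
    by simp
  show ?thesis
  proof (rule cell_loop[where B = B and i = i and x = x and y = y and x' = x', OF T J L c bdf lie _ _ _ _ _ _ _ int])
    show "(y has_real_derivative c * x t + d * y t) (at t)" for t
      unfolding y_def x_def using c0 by (auto intro!: derivative_eq_intros \<phi> simp: field_simps)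
    show "(x has_real_derivative x' t) (at t)" for t
      unfolding x_def x'_def using c0
      by (auto intro!: derivative_eq_intros \<phi> \<phi>' simp: field_simps power2_eq_square)
    show "continuous_on UNIV x'"
      unfolding x'_def \<phi>''_def \<phi>_def using c0 by (auto intro!: continuous_intros)
  qed (simp_all add: x_def y_def \<phi>_def \<phi>'_def)
qed

lemma bump_moment: "((\<lambda>s. exp (- d * s / 2) * (s\<^sup>2 * (T - s)\<^sup>2)) has_integral
    integral {0..T} (\<lambda>s. exp (- d * s / 2) * (s\<^sup>2 * (T - s)\<^sup>2))) {0..T}"
  by (intro integrable_integral integrable_continuous_real continuous_intros) auto

context
  fixes J :: "nat set" and i :: nat and L :: "'n heis set" and B :: "nat \<Rightarrow> 'n heis"
    and Y :: "'n heis" and b c f :: real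
  assumes J: "finite J" "i \<in> J"
    and L: "subspace L" "B i \<in> L" "Y \<in> L" "Z \<in> L"
    and c: "D (B i) = c *\<^sub>R Y" and bdf: "D Y = b *\<^sub>R B i + d *\<^sub>R Y + f *\<^sub>R Z" and lie: "lie (B i) Y = Z"
    and c0: "c \<noteq> 0"
begin

text \<open>Fast loops: for small \<open>T\<close> the quadratic part is positive, so a suitable amplitude solves
  \<open>K a\<^sup>2 + 2 f c m a = 2 c I\<close> for every \<open>I\<close> with the sign of \<open>c\<close>.\<close>

lemma cell_gains_sign:
  "\<exists>\<kappa>>0. \<forall>I z0. c * I \<ge> 0 \<longrightarrow>
     steers (hexp ` L) \<X> J B (hexp (z0 *\<^sub>R Z)) (hexp ((\<kappa> * (z0 + I)) *\<^sub>R Z))"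
proof -
  define \<Delta> where "\<Delta> = d\<^sup>2 + 4 * b * c"
  \<comment> \<open>Then \<open>T \<le> 1\<close> and \<open>|\<Delta>| T\<^sup>2 \<le> 1\<close>.\<close>
  define T where "T = 1 / (1 + \<bar>\<Delta>\<bar>)"
  have T: "T > 0" "T \<le> 1" "\<bar>\<Delta>\<bar> * T \<le> 1" by (auto simp: T_def field_simps)
  have "\<bar>\<Delta> * T\<^sup>2\<bar> \<le> 1"
    using mult_mono[OF T(3,2)] T(1) by (simp add: abs_mult power2_eq_square mult.assoc)
  then have K: "T ^ 7 * (48 + \<Delta> * T\<^sup>2) / 2520 > 0" using T(1) by simp
  show ?thesis
  proof (intro exI[of _ "exp (d * T)"] conjI allI impI)
    fix I z0 assume "c * I \<ge> 0"
    define m where "m = integral {0..T} (\<lambda>s. exp (- d * s / 2) * (s\<^sup>2 * (T - s)\<^sup>2))"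
    have "(f * c * m)\<^sup>2 + T ^ 7 * (48 + \<Delta> * T\<^sup>2) / 2520 * (2 * c * I) \<ge> 0"
    proof (intro add_nonneg_nonneg mult_nonneg_nonneg[OF less_imp_le[OF K]])
      show "2 * c * I \<ge> 0" using \<open>c * I \<ge> 0\<close> by linarith
    qed simp
    then obtain a where "2 * c * I = a\<^sup>2 * (T ^ 7 * (48 + \<Delta> * T\<^sup>2) / 2520) + 2 * a * (f * c * m)"
      using K quadratic_attains by (metis less_irrefl)
    then show "steers (hexp ` L) \<X> J B (hexp (z0 *\<^sub>R Z)) (hexp ((exp (d * T) * (z0 + I)) *\<^sub>R Z))"
      using T(1) bump_moment unfolding \<Delta>_def m_def
      by (intro cell_bump_loop[where B = B and i = i, OF _ J L c bdf lie c0]) auto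
  qed simp
qed

text \<open>Slow loops: if \<open>d\<^sup>2 + 4 b c < 0\<close>, the quadratic part is negative for large \<open>T\<close>. If \<open>d = 0\<close> and
  \<open>f \<noteq> 0\<close>, the least value of \<open>K a\<^sup>2 + 2 f c m a\<close> is \<open>- (f c m)\<^sup>2 / K\<close>, where \<open>m\<close> grows like \<open>T\<^sup>5\<close> and \<open>K\<close> at most like
  \<open>T\<^sup>9\<close>, so that it tends to minus infinity; the time then depends on \<open>I\<close>, but the factor
  \<open>\<kappa> = e\<^bsup>d T\<^esup> = 1\<close> does not.\<close>

lemma cell_gains_opposite_sign:
  assumes "d\<^sup>2 + 4 * b * c < 0 \<or> d = 0 \<and> f \<noteq> 0"
  shows "\<exists>\<kappa>>0. \<forall>I z0. c * I \<le> 0 \<longrightarrow>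
     steers (hexp ` L) \<X> J B (hexp (z0 *\<^sub>R Z)) (hexp ((\<kappa> * (z0 + I)) *\<^sub>R Z))"
proof (cases "d\<^sup>2 + 4 * b * c < 0")
  case True
  define \<Delta> where "\<Delta> = d\<^sup>2 + 4 * b * c"
  \<comment> \<open>For \<open>T \<ge> 1\<close> it suffices that \<open>48 + \<Delta> T < 0\<close>.\<close>
  define T where "T = 1 - 48 / \<Delta>"
  have \<Delta>: "\<Delta> < 0" using True by (simp add: \<Delta>_def)
  then have T: "T \<ge> 1" by (simp add: T_def divide_nonpos_neg)
  then have "T \<le> T\<^sup>2" by (simp add: power2_eq_square)
  then have "\<Delta> * T\<^sup>2 \<le> \<Delta> * T" using \<Delta> by simp
  also have "\<Delta> * T = \<Delta> - 48" using \<Delta> by (simp add: T_def algebra_simps)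
  finally have K: "T ^ 7 * (48 + \<Delta> * T\<^sup>2) / 2520 < 0"
    using T \<Delta> by (simp add: mult_pos_neg)
  show ?thesis
  proof (intro exI[of _ "exp (d * T)"] conjI allI impI)
    fix I z0 assume "c * I \<le> 0"
    define m where "m = integral {0..T} (\<lambda>s. exp (- d * s / 2) * (s\<^sup>2 * (T - s)\<^sup>2))"
    have "(f * c * m)\<^sup>2 + T ^ 7 * (48 + \<Delta> * T\<^sup>2) / 2520 * (2 * c * I) \<ge> 0"
    proof (intro add_nonneg_nonneg mult_nonpos_nonpos[OF less_imp_le[OF K]])
      show "2 * c * I \<le> 0" using \<open>c * I \<le> 0\<close> by linarith
    qed simp
    then obtain a where "2 * c * I = a\<^sup>2 * (T ^ 7 * (48 + \<Delta> * T\<^sup>2) / 2520) + 2 * a * (f * c * m)"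
      using K quadratic_attains by (metis less_irrefl)
    then show "steers (hexp ` L) \<X> J B (hexp (z0 *\<^sub>R Z)) (hexp ((exp (d * T) * (z0 + I)) *\<^sub>R Z))"
      using T bump_moment unfolding \<Delta>_def m_def
      by (intro cell_bump_loop[where B = B and i = i, OF _ J L c bdf lie c0]) auto
  qed simp
next
  case False
  define \<Delta> where "\<Delta> = d\<^sup>2 + 4 * b * c"
  have \<Delta>: "\<Delta> \<ge> 0" and d: "d = 0" and f: "f \<noteq> 0" using False assms by (auto simp: \<Delta>_def)
  show ?thesis
  proof (intro exI[of _ "1::real"] conjI allI impI)
    fix I z0 assume I: "c * I \<le> 0"
    define q where "q = - (2 * c * I)"
    have q: "q \<ge> 0" using I unfolding q_def by linarith
    \<comment> \<open>Using \<open>T \<ge> 1\<close>, the discriminant condition \<open>K q \<le> (f c m)\<^sup>2\<close> is reduced to one that is linear in \<open>T\<close>.\<close>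
    define T where "T = max 1 (q * (48 + \<Delta>) / (f * c)\<^sup>2)"
    have T: "T \<ge> 1" by (simp add: T_def)
    have fc: "(f * c)\<^sup>2 > 0" using f c0 by simp
    have "q * (48 + \<Delta>) \<le> T * (f * c)\<^sup>2"
      using fc by (simp add: T_def flip: pos_divide_le_eq)
    define m where "m = T ^ 5 / 30"
    define R where "R s = T\<^sup>2 * s^3 / 3 - T * s^4 / 2 + s^5 / 5" for s
    have "((\<lambda>s. s\<^sup>2 * (T - s)\<^sup>2) has_integral R T - R 0) {0..T}"
    proof (intro fundamental_theorem_of_calculus)
      fix s
      have "(R has_real_derivative s\<^sup>2 * (T - s)\<^sup>2) (at s within {0..T})"
        unfolding R_def by (auto intro!: derivative_eq_intros simp: power2_eq_square power3_eq_cube power4_eq_xxxx algebra_simps)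
      then show "(R has_vector_derivative s\<^sup>2 * (T - s)\<^sup>2) (at s within {0..T})"
        by (simp add: has_real_derivative_iff_has_vector_derivative)
    qed (use T in simp)
    moreover have "R T - R 0 = m"
      by (simp add: R_def m_def) (simp add: power2_eq_square power3_eq_cube power4_eq_xxxx eval_nat_numeral)
    ultimately have m: "((\<lambda>s. exp (- d * s / 2) * (s\<^sup>2 * (T - s)\<^sup>2)) has_integral m) {0..T}"
      by (simp add: d)
    have K: "T ^ 7 * (48 + \<Delta> * T\<^sup>2) / 2520 > 0"
      using T \<Delta> by (intro divide_pos_pos mult_pos_pos add_pos_nonneg) auto
    have "T ^ 7 * (48 + \<Delta> * T\<^sup>2) / 2520 * q \<le> (f * c * m)\<^sup>2"
    proof -
      have "1 \<le> T\<^sup>2" using T by simp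
      then have "48 + \<Delta> * T\<^sup>2 \<le> (48 + \<Delta>) * T\<^sup>2" by (simp add: algebra_simps)
      then have "T ^ 7 * (48 + \<Delta> * T\<^sup>2) * q \<le> T ^ 7 * ((48 + \<Delta>) * T\<^sup>2) * q"
        using T q by (intro mult_right_mono mult_left_mono) auto
      also have "\<dots> = T ^ 9 * (q * (48 + \<Delta>))"
        by (simp add: power_add[of T 7 2, simplified] algebra_simps)
      also have "\<dots> \<le> T ^ 9 * (T * (f * c)\<^sup>2)"
        using \<open>q * (48 + \<Delta>) \<le> T * (f * c)\<^sup>2\<close> T by (intro mult_left_mono) auto
      also have "\<dots> = 900 * (f * c * m)\<^sup>2"
        by (simp add: m_def power_divide power_mult_distrib flip: power_mult) (simp add: eval_nat_numeral)
      finally have "T ^ 7 * (48 + \<Delta> * T\<^sup>2) * q \<le> 900 * (f * c * m)\<^sup>2" .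
      moreover have "0 \<le> (f * c * m)\<^sup>2" by simp
      ultimately have "T ^ 7 * (48 + \<Delta> * T\<^sup>2) * q \<le> 2520 * (f * c * m)\<^sup>2" by linarith
      then show ?thesis by simp
    qed
    then have "(f * c * m)\<^sup>2 + T ^ 7 * (48 + \<Delta> * T\<^sup>2) / 2520 * (2 * c * I) \<ge> 0"
      by (simp add: q_def)
    then obtain a where "2 * c * I = a\<^sup>2 * (T ^ 7 * (48 + \<Delta> * T\<^sup>2) / 2520) + 2 * a * (f * c * m)"
      using K quadratic_attains by (metis less_irrefl)
    then have "steers (hexp ` L) \<X> J B (hexp (z0 *\<^sub>R Z)) (hexp ((exp (d * T) * (z0 + I)) *\<^sub>R Z))"
      using T m unfolding \<Delta>_def
      by (intro cell_bump_loop[where B = B and i = i, OF _ J L c bdf lie c0]) auto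
    then show "steers (hexp ` L) \<X> J B (hexp (z0 *\<^sub>R Z)) (hexp ((1 * (z0 + I)) *\<^sub>R Z))"
      by (simp add: d)
  qed simp
qed

end

text \<open>Going up far enough first makes the remaining step, after rescaling, a downward one.\<close>

lemma steers_vertical:
  assumes up: "\<exists>\<kappa>>0. \<forall>I z0. I \<ge> 0 \<longrightarrow>
     steers G \<X> J B (hexp (z0 *\<^sub>R Z)) (hexp ((\<kappa> * (z0 + I)) *\<^sub>R Z))"
    and down: "\<exists>\<kappa>>0. \<forall>I z0. I \<le> 0 \<longrightarrow>
     steers G \<X> J B (hexp (z0 *\<^sub>R Z)) (hexp ((\<kappa> * (z0 + I)) *\<^sub>R Z))"
  shows "steers G \<X> J B (hexp (a *\<^sub>R Z)) (hexp (b *\<^sub>R Z))"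
proof -
  obtain \<kappa> where \<kappa>: "\<kappa> > 0"
    "\<And>I z0. I \<ge> 0 \<Longrightarrow> steers G \<X> J B (hexp (z0 *\<^sub>R Z)) (hexp ((\<kappa> * (z0 + I)) *\<^sub>R Z))"
    using up by blast
  obtain \<mu> where \<mu>: "\<mu> > 0"
    "\<And>I z0. I \<le> 0 \<Longrightarrow> steers G \<X> J B (hexp (z0 *\<^sub>R Z)) (hexp ((\<mu> * (z0 + I)) *\<^sub>R Z))"
    using down by blast
  \<comment> \<open>The step up ends at least at \<open>b / \<mu>\<close>, the level from which the motion down with \<open>I = 0\<close> ends in \<open>b\<close>.\<close>
  define I where "I = max 0 (b / (\<kappa> * \<mu>) - a)"
  define z where "z = \<kappa> * (a + I)"
  have "a + I \<ge> b / (\<kappa> * \<mu>)" by (simp add: I_def)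
  then have "\<kappa> * (b / (\<kappa> * \<mu>)) \<le> z"
    unfolding z_def using \<kappa>(1) by (intro mult_left_mono) auto
  then have "b / \<mu> - z \<le> 0" using \<kappa>(1) by simp
  then have "steers G \<X> J B (hexp (z *\<^sub>R Z)) (hexp ((\<mu> * (z + (b / \<mu> - z))) *\<^sub>R Z))"
    by (rule \<mu>(2))
  moreover have "steers G \<X> J B (hexp (a *\<^sub>R Z)) (hexp (z *\<^sub>R Z))"
    unfolding z_def by (rule \<kappa>(2)) (simp add: I_def)
  ultimately show ?thesis using \<mu>(1) steers_trans by fastforce
qed

end

section \<open>Functions that grow along all trajectories\<close>

lemma trajectory_has_integral:
  assumes "trajectory \<X> J B u T \<gamma>" "0 \<le> a" "a \<le> b" "b \<le> T"
  shows "((\<lambda>s. \<X> (\<gamma> s) + (\<Sum>j\<in>J. u s j *\<^sub>R rinv (B j) (\<gamma> s))) has_integral \<gamma> b - \<gamma> a) {a..b}"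
    (is "(?F has_integral _) _")
proof -
  have int: "(?F has_integral \<gamma> t - \<gamma> 0) {0..t}" if "t \<in> {0..T}" for t
    using assms(1) that unfolding trajectory_def by blast
  have "?F integrable_on {0..b}" using int[of b] assms by (auto intro: has_integral_integrable)
  then have ab: "?F integrable_on {a..b}"
    by (rule integrable_on_subinterval) (use assms in auto)
  have "integral {0..a} ?F + integral {a..b} ?F = integral {0..b} ?F"
    using assms \<open>?F integrable_on {0..b}\<close> by (intro Henstock_Kurzweil_Integration.integral_combine)
  then have "integral {a..b} ?F = \<gamma> b - \<gamma> a"
    using integral_unique[OF int[of a]] integral_unique[OF int[of b]] assms
    by (simp add: algebra_simps)
  then show ?thesis using integrable_integral[OF ab] by simp
qed

text \<open>A trajectory is only Lipschitz, but if \<open>W\<close> has no derivative in the directions of the inputs at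
  \<open>\<gamma> t\<close>, then near \<open>t\<close> the inputs contribute a bounded function times one that tends to \<open>0\<close>. So the
  image of the velocity under the differential of \<open>W\<close> at \<open>\<gamma> t\<close> is continuous at \<open>t\<close>, and the chain rule
  holds there.\<close>

lemma trajectory_has_derivative_along:
  fixes \<X> :: "'n::finite heis \<Rightarrow> 'n heis" and W :: "'n heis \<Rightarrow> real"
  assumes \<X>: "linear_field \<X>" and J: "finite J" and u: "admissible_input J u"
    and \<gamma>: "trajectory \<X> J B u T \<gamma>" and t: "t \<in> {0..T}"
    and W: "(W has_derivative P) (at (\<gamma> t))"
    and P0: "\<And>j. j \<in> J \<Longrightarrow> P (rinv (B j) (\<gamma> t)) = 0"
  shows "((\<lambda>s. W (\<gamma> s)) has_real_derivative P (\<X> (\<gamma> t))) (at t within {0..T})"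
proof -
  define F where "F s = \<X> (\<gamma> s) + (\<Sum>j\<in>J. u s j *\<^sub>R rinv (B j) (\<gamma> s))" for s
  have cont: "continuous_on {0..T} \<gamma>" using \<gamma> unfolding trajectory_def by blast
  have int: "(F has_integral \<gamma> b - \<gamma> a) {a..b}" if "0 \<le> a" "a \<le> b" "b \<le> T" for a b
    using trajectory_has_integral[OF \<gamma> that] by (simp add: F_def[abs_def])
  have P: "bounded_linear P" using W by (rule has_derivative_bounded_linear)
  have "\<forall>j\<in>J. \<exists>M. \<forall>s\<in>{0..T}. \<bar>u s j\<bar> \<le> M"
    using u unfolding admissible_input_def bounded_iff by (metis image_eqI real_norm_def)
  then obtain M where M: "\<And>j s. j \<in> J \<Longrightarrow> s \<in> {0..T} \<Longrightarrow> \<bar>u s j\<bar> \<le> M j" by metis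
  have cX: "continuous_on {0..T} (\<lambda>s. \<X> (\<gamma> s))"
    using continuous_on_compose2[OF linear_field_continuous_on[OF \<X>, of UNIV] cont] by simp
  have cB: "continuous_on {0..T} (\<lambda>s. rinv (B j) (\<gamma> s))" for j
    unfolding rinv_eq' by (intro continuous_intros cont)
  define G where "G s = norm (\<X> (\<gamma> s)) + (\<Sum>j\<in>J. M j * norm (rinv (B j) (\<gamma> s)))" for s
  have "continuous_on {0..T} G" unfolding G_def by (intro continuous_intros cX cB)
  then have "bounded (G ` {0..T})" by (intro compact_imp_bounded compact_continuous_image) auto
  then obtain C where C: "\<And>s. s \<in> {0..T} \<Longrightarrow> \<bar>G s\<bar> \<le> C"
    unfolding bounded_iff by (metis image_eqI real_norm_def)
  have FC: "norm (F s) \<le> C" if "s \<in> {0..T}" for s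
  proof -
    have "norm (F s) \<le> G s" unfolding F_def G_def
      using M[OF _ that]
      by (intro norm_triangle_le add_left_mono order_trans[OF norm_sum] sum_mono) (auto intro: mult_right_mono)
    then show ?thesis using C[OF that] by simp
  qed
  have C0: "C \<ge> 0" using C[OF t] by simp
  have lip_le: "norm (\<gamma> b - \<gamma> a) \<le> C * \<bar>b - a\<bar>" if "0 \<le> a" "a \<le> b" "b \<le> T" for a b
    using has_integral_bound[OF C0, of F "\<gamma> b - \<gamma> a" a b] int[OF that] FC that
    by (simp add: content_real)
  have lip: "norm (\<gamma> s - \<gamma> t) \<le> C * \<bar>s - t\<bar>" if "s \<in> {0..T}" for s
    using lip_le[of s t] lip_le[of t s] that t
    by (cases "s \<le> t") (auto simp: norm_minus_commute abs_minus_commute)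
  have PF: "P (F s) = P (\<X> (\<gamma> s)) + (\<Sum>j\<in>J. u s j * P (rinv (B j) (\<gamma> s)))" for s
    unfolding F_def by (simp add: linear_add linear_sum linear_scale bounded_linear.linear[OF P])
  have "continuous (at t within {0..T}) (\<lambda>s. P (F s))"
  proof -
    have "((\<lambda>s. u s j * P (rinv (B j) (\<gamma> s))) \<longlongrightarrow> 0) (at t within {0..T})" if j: "j \<in> J" for j
    proof (rule Lim_null_comparison)
      show "\<forall>\<^sub>F s in at t within {0..T}. norm (u s j * P (rinv (B j) (\<gamma> s))) \<le> M j * norm (P (rinv (B j) (\<gamma> s)))"
        using M[OF j] by (auto simp: eventually_at_filter abs_mult intro!: always_eventually mult_right_mono)
      have "((\<lambda>s. P (rinv (B j) (\<gamma> s))) \<longlongrightarrow> P (rinv (B j) (\<gamma> t))) (at t within {0..T})"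
        using cB[of j] t by (intro bounded_linear.tendsto[OF P]) (simp add: continuous_on_def)
      then show "((\<lambda>s. M j * norm (P (rinv (B j) (\<gamma> s)))) \<longlongrightarrow> 0) (at t within {0..T})"
        using P0[OF j] by (auto intro!: tendsto_eq_intros)
    qed
    moreover have "((\<lambda>s. P (\<X> (\<gamma> s))) \<longlongrightarrow> P (\<X> (\<gamma> t))) (at t within {0..T})"
      using cX t by (intro bounded_linear.tendsto[OF P]) (simp add: continuous_on_def)
    ultimately have "((\<lambda>s. P (\<X> (\<gamma> s)) + (\<Sum>j\<in>J. u s j * P (rinv (B j) (\<gamma> s)))) \<longlongrightarrow>
        P (\<X> (\<gamma> t)) + (\<Sum>j\<in>J. 0)) (at t within {0..T})"
      by (intro tendsto_add tendsto_sum)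
    then show ?thesis
      unfolding continuous_within PF using P0 by simp
  qed
  then have "((\<lambda>s. integral {0..s} (\<lambda>s. P (F s))) has_vector_derivative P (F t)) (at t within {0..T})"
    using integral_has_vector_derivative_continuous_at[of "\<lambda>s. P (F s)" 0 T t "{}"] t
      integrable_linear[OF has_integral_integrable[OF int[of 0 T]] P]
    by (simp add: o_def)
  moreover have "integral {0..s} (\<lambda>s. P (F s)) = P (\<gamma> s) - P (\<gamma> 0)" if "s \<in> {0..T}" for s
    using integral_unique[OF has_integral_linear[OF int[of 0 s] P]] that
    by (simp add: o_def linear_diff[OF bounded_linear.linear[OF P]])
  ultimately have "((\<lambda>s. P (\<gamma> s) - P (\<gamma> 0)) has_vector_derivative P (F t)) (at t within {0..T})"
    using t by (auto intro: has_vector_derivative_transform[rotated 2])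
  then have d1: "((\<lambda>s. P (\<gamma> s) - P (\<gamma> 0)) has_real_derivative P (\<X> (\<gamma> t))) (at t within {0..T})"
    using P0 by (simp add: PF has_real_derivative_iff_has_vector_derivative)
  have d2: "((\<lambda>s. W (\<gamma> s) - P (\<gamma> s)) has_real_derivative 0) (at t within {0..T})"
    unfolding has_field_derivative_def has_derivative_within_alt
  proof (intro conjI allI impI)
    fix e :: real assume e: "e > 0"
    \<comment> \<open>\<open>C\<close> may be \<open>0\<close>, hence the summand \<open>1\<close>\<close>
    define e' where "e' = e / (C + 1)"
    have e': "e' > 0" "e' * C \<le> e" using e C0 by (auto simp: e'_def field_simps)
    obtain \<delta> where \<delta>: "\<delta> > 0"
      "\<And>g. norm (g - \<gamma> t) < \<delta> \<Longrightarrow> norm (W g - W (\<gamma> t) - P (g - \<gamma> t)) \<le> e' * norm (g - \<gamma> t)"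
      using W e'(1) unfolding has_derivative_at_alt by blast
    show "\<exists>\<delta>>0. \<forall>s\<in>{0..T}. norm (s - t) < \<delta> \<longrightarrow>
      norm (W (\<gamma> s) - P (\<gamma> s) - (W (\<gamma> t) - P (\<gamma> t)) - 0 * (s - t)) \<le> e * norm (s - t)"
    proof (intro exI[of _ "\<delta> / (C + 1)"] conjI ballI impI)
      fix s assume s: "s \<in> {0..T}" "norm (s - t) < \<delta> / (C + 1)"
      have "C * \<bar>s - t\<bar> \<le> (C + 1) * \<bar>s - t\<bar>" by (simp add: algebra_simps)
      also have "\<dots> < \<delta>" using s(2) C0 by (simp add: field_simps)
      finally have "norm (\<gamma> s - \<gamma> t) < \<delta>" using lip[OF s(1)] by linarith
      then have "norm (W (\<gamma> s) - W (\<gamma> t) - P (\<gamma> s - \<gamma> t)) \<le> e' * norm (\<gamma> s - \<gamma> t)" by (rule \<delta>(2))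
      also have "\<dots> \<le> e' * (C * \<bar>s - t\<bar>)" using lip[OF s(1)] e' by (intro mult_left_mono) auto
      also have "\<dots> \<le> e * \<bar>s - t\<bar>" using mult_right_mono[OF e'(2), of "\<bar>s - t\<bar>"] by (simp add: mult.assoc)
      finally show "norm (W (\<gamma> s) - P (\<gamma> s) - (W (\<gamma> t) - P (\<gamma> t)) - 0 * (s - t)) \<le> e * norm (s - t)"
        by (simp add: linear_diff[OF bounded_linear.linear[OF P]] algebra_simps)
    qed (use \<delta> C0 in auto)
  qed (simp add: bounded_linear_mult_right)
  show ?thesis
    using DERIV_add[OF DERIV_add[OF d1 d2] DERIV_const[of "P (\<gamma> 0)"]] by simp
qed

text \<open>The function \<open>e\<^bsup>- d t\<^esup> W\<close> does not decrease along trajectories, so no trajectory leaves the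
  set where \<open>W\<close> is nonnegative.\<close>

lemma not_controllable_if_growing:
  fixes \<X> :: "'n::finite heis \<Rightarrow> 'n heis" and W :: "'n heis \<Rightarrow> real"
  assumes \<X>: "linear_field \<X>" and J: "finite J"
    and W: "\<And>g. (W has_derivative P g) (at g)"
    and PB: "\<And>g j. j \<in> J \<Longrightarrow> P g (rinv (B j) g) = 0"
    and PX: "\<And>g. P g (\<X> g) \<ge> d * W g"
    and gh: "W g \<ge> 0" "W h < 0"
  shows "\<not> controllable UNIV \<X> J B"
proof
  assume "controllable UNIV \<X> J B"
  then obtain T u \<gamma> where T: "T \<ge> 0" and u: "admissible_input J u" and \<gamma>: "trajectory \<X> J B u T \<gamma>"
    and ends: "\<gamma> 0 = g" "\<gamma> T = h" unfolding controllable_def by blast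
  define k where "k t = exp (- d * t) * W (\<gamma> t)" for t
  have k: "(k has_real_derivative exp (- d * t) * (P (\<gamma> t) (\<X> (\<gamma> t)) - d * W (\<gamma> t))) (at t within {0..T})"
    if "t \<in> {0..T}" for t
    unfolding k_def
    by (auto intro!: derivative_eq_intros trajectory_has_derivative_along[OF \<X> J u \<gamma> that W PB]
        simp: algebra_simps)
  have "k 0 \<le> k T"
  proof (rule DERIV_nonneg_imp_increasing_open[OF T])
    show "continuous_on {0..T} k"
      using k DERIV_continuous continuous_on_eq_continuous_within by blast
    fix t assume t: "0 < t" "t < T"
    show "\<exists>y. (k has_real_derivative y) (at t) \<and> 0 \<le> y"
      using k[of t] t PX[of "\<gamma> t"] at_within_Icc_at[OF t] by (auto intro!: exI mult_nonneg_nonneg)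
  qed
  then have "W g \<le> exp (- d * T) * W h" by (simp add: k_def ends)
  moreover have "exp (- d * T) * W h < 0" using gh by (simp add: mult_pos_neg)
  ultimately show False using gh by simp
qed

text \<open>For \<open>d \<noteq> 0\<close> the equation for \<open>\<alpha>\<close> has roots with sum \<open>- d\<close>, so one of them is nonzero and can be divided
  by to get \<open>\<beta>\<close>. For \<open>d = 0\<close> the condition on \<open>\<delta>\<close> forces \<open>\<beta> = 0\<close>, and \<open>f = 0\<close> permits it.\<close>

lemma square_completion_constants:
  fixes b c d f :: real
  assumes c: "c > 0" and \<Delta>: "d\<^sup>2 + 4 * b * c \<ge> 0" and df: "d \<noteq> 0 \<or> f = 0"
  shows "\<exists>\<alpha> \<beta> \<delta>. \<alpha>\<^sup>2 + d * \<alpha> = b * c \<and> \<alpha> * \<beta> = c * f \<and> 2 * c * d * \<delta> = \<beta>\<^sup>2"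
proof (cases "d = 0")
  case True
  then show ?thesis
    using df \<Delta> by (intro exI[of _ "sqrt (4 * b * c) / 2"] exI[of _ 0]) (auto simp: power_divide)
next
  case False
  define r where "r = sqrt (d\<^sup>2 + 4 * b * c)"
  have r: "r\<^sup>2 = d\<^sup>2 + 4 * b * c" "r \<ge> 0" using \<Delta> by (simp_all add: r_def)
  define \<alpha> where "\<alpha> = - (d + sgn d * r) / 2"
  have "(sgn d)\<^sup>2 = 1" using False by (simp add: sgn_if)
  then have "\<alpha>\<^sup>2 + d * \<alpha> = (r\<^sup>2 - d\<^sup>2) / 4"
    unfolding \<alpha>_def by (simp add: power2_eq_square field_simps)
  moreover have "\<alpha> \<noteq> 0" unfolding \<alpha>_def using False r(2) by (auto simp: sgn_if)
  ultimately show ?thesis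
    using r c False by (intro exI[of _ \<alpha>] exI[of _ "c * f / \<alpha>"] exI[of _ "(c * f / \<alpha>)\<^sup>2 / (2 * c * d)"]) auto
qed

context heis_system begin

lemma linear_symp_left: "linear (\<lambda>\<xi>. symp \<xi> \<eta>)" and linear_symp_right: "linear (symp \<xi>)"
  by (auto intro!: linearI simp: symp_def lie_eq' inner_add_left inner_add_right
      add_divide_distrib diff_divide_distrib right_diff_distrib)

lemma symp_Z [simp]: "symp Z \<xi> = 0" "symp \<xi> Z = 0"
  by (simp_all add: symp_def)

lemma symp_antisym: "symp \<eta> \<xi> = - symp \<xi> \<eta>"
  by (simp add: symp_def lie_antisym[of \<eta> \<xi>])

text \<open>The growing function is \<open>V = z - \<Sum>i. ((\<alpha> y\<^sup>2 / 2 + \<beta> y) / c + \<delta>)\<close>, where \<open>z = \<zeta> + \<Sum>i. x y / 2\<close>. In the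
  coordinates \<open>x, y, z\<close> the inputs move only \<open>x\<close>, so they do not act on \<open>V\<close>. The constants are those that make
  \<open>2 c\<close> times the contribution of a cell to \<open>V' - d V\<close> the square \<open>(c x - \<alpha> y - \<beta>)\<^sup>2\<close>.\<close>

lemma not_controllable_decoupled:
  fixes X Y :: "nat \<Rightarrow> 'n heis"
  defines "N \<equiv> {1..CARD('n)}"
  assumes basis: "symplectic_basis X Y Z"
    and DX: "\<And>i. i \<in> N \<Longrightarrow> D (X i) = c i *\<^sub>R Y i"
    and DY: "\<And>i. i \<in> N \<Longrightarrow> D (Y i) = b i *\<^sub>R X i + d *\<^sub>R Y i + f i *\<^sub>R Z"
    and c: "\<And>i. i \<in> N \<Longrightarrow> c i > 0"
    and \<Delta>: "\<And>i. i \<in> N \<Longrightarrow> d\<^sup>2 + 4 * b i * c i \<ge> 0"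
    and df: "\<And>i. i \<in> N \<Longrightarrow> d \<noteq> 0 \<or> f i = 0"
  shows "\<not> controllable UNIV \<X> N X"
proof -
  have "\<forall>i\<in>N. \<exists>\<alpha> \<beta> \<delta>. \<alpha>\<^sup>2 + d * \<alpha> = b i * c i \<and> \<alpha> * \<beta> = c i * f i \<and> 2 * c i * d * \<delta> = \<beta>\<^sup>2"
    using square_completion_constants c \<Delta> df by blast
  then obtain \<alpha> \<beta> \<delta> where cst:
    "\<And>i. i \<in> N \<Longrightarrow> (\<alpha> i)\<^sup>2 + d * \<alpha> i = b i * c i" "\<And>i. i \<in> N \<Longrightarrow> \<alpha> i * \<beta> i = c i * f i"
    "\<And>i. i \<in> N \<Longrightarrow> 2 * c i * d * \<delta> i = (\<beta> i)\<^sup>2" by metis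
  define S where "S = X ` N \<union> Y ` N \<union> {Z}"
  have ind: "independent S" and span: "span S = UNIV"
    and lie: "\<And>i j. i \<in> N \<Longrightarrow> j \<in> N \<Longrightarrow> lie (X i) (Y j) = (if i = j then Z else 0)"
      "\<And>i j. i \<in> N \<Longrightarrow> j \<in> N \<Longrightarrow> lie (X i) (X j) = 0" "\<And>i j. i \<in> N \<Longrightarrow> j \<in> N \<Longrightarrow> lie (Y i) (Y j) = 0"
    using basis unfolding symplectic_basis_def Let_def S_def N_def by blast+
  have fin: "finite N" by (simp add: N_def)
  have symp: "symp (X i) (Y j) = (if i = j then 1 else 0)" "symp (X i) (X j) = 0" "symp (Y i) (Y j) = 0"
    "symp (Y i) (X j) = (if i = j then -1 else 0)"
    if "i \<in> N" "j \<in> N" for i j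
    using that lie Z_coord_nz symp_antisym[of "Y i" "X j"] by (auto simp: symp_def)
  have XZ: "X i \<noteq> Z" "Y i \<noteq> Z" if "i \<in> N" for i
    using lie(1)[OF that that] Z_nz by (metis lie_Z_left lie_Z_right)+
  obtain pz :: "'n heis \<Rightarrow> real" where pz: "linear pz" "\<forall>\<xi>\<in>S. pz \<xi> = (if \<xi> = Z then 1 else 0)"
    using linear_independent_extend[OF ind, of "\<lambda>\<xi>. if \<xi> = Z then 1 else 0"] by blast
  have pzv: "pz Z = 1" "\<And>i. i \<in> N \<Longrightarrow> pz (X i) = 0" "\<And>i. i \<in> N \<Longrightarrow> pz (Y i) = 0"
    using pz(2) XZ by (auto simp: S_def)
  define px where "px i \<xi> = symp \<xi> (Y i)" for i \<xi>
  define py where "py i \<xi> = symp (X i) \<xi>" for i \<xi>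
  have lin: "linear (px i)" "linear (py i)" for i
    unfolding px_def py_def by (rule linear_symp_left linear_symp_right)+
  have pv: "px i (X j) = (if i = j then 1 else 0)" "px i (Y j) = 0" "px i Z = 0"
    "py i (X j) = 0" "py i (Y j) = (if i = j then 1 else 0)" "py i Z = 0" if "i \<in> N" "j \<in> N" for i j
    using symp[OF that] symp[OF that(2,1)] by (auto simp: px_def py_def)
  have expand: "(\<Sum>i\<in>N. px i \<xi> *\<^sub>R X i + py i \<xi> *\<^sub>R Y i) + pz \<xi> *\<^sub>R Z = \<xi>" for \<xi>
  proof -
    define E where "E \<xi> = (\<Sum>i\<in>N. px i \<xi> *\<^sub>R X i + py i \<xi> *\<^sub>R Y i) + pz \<xi> *\<^sub>R Z" for \<xi>
    have "linear E"
      by (rule linearI) (simp_all add: E_def linear_add[OF lin(1)] linear_add[OF lin(2)] linear_add[OF pz(1)]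
          linear_scale[OF lin(1)] linear_scale[OF lin(2)] linear_scale[OF pz(1)] scaleR_add_left sum.distrib
          scaleR_add_right scaleR_sum_right)
    moreover have "E \<xi> = \<xi>" if "\<xi> \<in> S" for \<xi>
      using that fin unfolding S_def E_def
      by (auto simp: pv pzv sum.distrib if_distrib if_distribR sum.delta cong: if_cong sum.cong)
    ultimately have "E \<xi> = id \<xi>"
      using linear_eq_on_span[of E id S \<xi>] span linear_id by (simp add: id_def)
    then show ?thesis by (simp add: E_def)
  qed
  have D_expand: "D \<xi> = (\<Sum>i\<in>N. px i \<xi> *\<^sub>R (c i *\<^sub>R Y i) +
      py i \<xi> *\<^sub>R (b i *\<^sub>R X i + d *\<^sub>R Y i + f i *\<^sub>R Z)) + pz \<xi> *\<^sub>R d *\<^sub>R Z" for \<xi>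
    by (subst expand[of \<xi>, symmetric]) (simp add: D_simps D_Z DX DY cong: sum.cong)
  have Dv: "px i (D \<xi>) = b i * py i \<xi>" "py i (D \<xi>) = c i * px i \<xi> + d * py i \<xi>" if i: "i \<in> N" for i \<xi>
  proof -
    show "px i (D \<xi>) = b i * py i \<xi>" "py i (D \<xi>) = c i * px i \<xi> + d * py i \<xi>"
      unfolding D_expand[of \<xi>] using i fin
      by (simp_all add: linear_add[OF lin(1)] linear_add[OF lin(2)] linear_scale[OF lin(1)] linear_scale[OF lin(2)]
          linear_sum[OF lin(1)] linear_sum[OF lin(2)] pv sum.distrib if_distrib if_distribR sum.delta
          cong: if_cong sum.cong)
  qed
  have Dz: "pz (D \<xi>) = d * pz \<xi> + (\<Sum>i\<in>N. f i * py i \<xi>)" for \<xi>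
    unfolding D_expand[of \<xi>]
    by (simp add: linear_add[OF pz(1)] linear_scale[OF pz(1)] linear_sum[OF pz(1)] pzv mult.commute
        cong: sum.cong)
  define V where "V \<xi> = pz \<xi> +
      (\<Sum>i\<in>N. px i \<xi> * py i \<xi> / 2 - (\<alpha> i * (py i \<xi>)\<^sup>2 / 2 + \<beta> i * py i \<xi>) / c i - \<delta> i)" for \<xi>
  define V' where "V' \<xi> \<eta> = pz \<eta> + (\<Sum>i\<in>N. (px i \<eta> * py i \<xi> + px i \<xi> * py i \<eta>) / 2 -
      (\<alpha> i * py i \<xi> + \<beta> i) * py i \<eta> / c i)" for \<xi> \<eta>
  have dlin: "(g has_derivative g) (at \<xi>)" if "linear g" for g :: "'n heis \<Rightarrow> real" and \<xi>
    using that by (simp add: linear_conv_bounded_linear bounded_linear_imp_has_derivative)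
  have c0: "c i \<noteq> 0" if "i \<in> N" for i using c[OF that] by simp
  have dV: "(V has_derivative V' \<xi>) (at \<xi>)" for \<xi>
    unfolding V_def V'_def
    by (auto intro!: derivative_eq_intros dlin lin pz simp: c0 fun_eq_iff power2_eq_square algebra_simps
        add_divide_distrib intro!: sum.cong)
  define W where "W g = V (hlog g)" for g
  define P where "P g v = V' (hlog g) (dhlog g v)" for g v
  show ?thesis
  proof (rule not_controllable_if_growing[OF linear_field fin, where W = W and P = P and d = d])
    show "(W has_derivative P g) (at g)" for g
      unfolding W_def P_def using diff_chain_at[OF hlog_has_derivative dV] by (simp add: o_def)
    show "P g (rinv (X j) g) = 0" if "j \<in> N" for g j
    proof -
      define \<xi> where "\<xi> = hlog g"
      have "P g (rinv (X j) g) = V' \<xi> (X j + (1/2) *\<^sub>R lie \<xi> (X j))"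
        using rinv_hexp[of "X j" \<xi>] by (metis P_def \<xi>_def dhlog_dhexp hexp_hlog)
      also have "lie \<xi> (X j) = - py j \<xi> *\<^sub>R Z"
        by (simp add: lie_symp py_def symp_antisym[of \<xi>])
      also have "V' \<xi> (X j + (1/2) *\<^sub>R (- py j \<xi> *\<^sub>R Z)) = 0"
        unfolding V'_def using that fin
        by (simp add: linear_add[OF lin(1)] linear_add[OF lin(2)] linear_scale[OF lin(1)] linear_scale[OF lin(2)]
            linear_add[OF pz(1)] linear_scale[OF pz(1)] linear_neg[OF lin(1)] linear_neg[OF lin(2)] linear_neg[OF pz(1)]
            linear_diff[OF lin(1)] linear_diff[OF lin(2)] linear_diff[OF pz(1)]
            pv pzv if_distrib if_distribR sum.delta cong: if_cong sum.cong)
      finally show ?thesis .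
    qed
    show "d * W g \<le> P g (\<X> g)" for g
    proof -
      define \<xi> where "\<xi> = hlog g"
      have "P g (\<X> g) = V' \<xi> (D \<xi>)"
        using linear_field_hexp[OF linear_field, of \<xi>] by (metis P_def \<xi>_def dhlog_dhexp hexp_hlog)
      moreover have "d * V \<xi> \<le> V' \<xi> (D \<xi>)"
      proof -
        have "d * (px i \<xi> * py i \<xi> / 2 - (\<alpha> i * (py i \<xi>)\<^sup>2 / 2 + \<beta> i * py i \<xi>) / c i - \<delta> i) \<le>
          f i * py i \<xi> + ((px i (D \<xi>) * py i \<xi> + px i \<xi> * py i (D \<xi>)) / 2 -
            (\<alpha> i * py i \<xi> + \<beta> i) * py i (D \<xi>) / c i)" (is "?l \<le> ?r") if i: "i \<in> N" for i
        proof -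
          define x y where "x = px i \<xi>" and "y = py i \<xi>"
          have ci: "c i \<noteq> 0" using c[OF i] by simp
          have "(?r - ?l) * (2 * c i) = 2 * c i * f i * y + (b i * c i) * y\<^sup>2 + (c i)\<^sup>2 * x\<^sup>2 + 
             c i * d * x * y - 2 * (\<alpha> i * y + \<beta> i) * (c i * x + d * y) - c i * d * x * y +
             d * \<alpha> i * y\<^sup>2 + 2 * d * \<beta> i * y + 2 * c i * d * \<delta> i"
            unfolding Dv[OF i] x_def[symmetric] y_def[symmetric] using ci
            by (simp add: field_simps power2_eq_square)
          also have "\<dots> = (c i * x - \<alpha> i * y - \<beta> i)\<^sup>2"
            unfolding cst(1)[OF i, symmetric] cst(3)[OF i] using cst(2)[OF i]
            by algebra
          finally have "0 \<le> (?r - ?l) * (2 * c i)" by simp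
          then have "0 \<le> ?r - ?l" using c[OF i] by (simp add: zero_le_mult_iff)
          then show ?thesis by simp
        qed
        then have "(\<Sum>i\<in>N. d * (px i \<xi> * py i \<xi> / 2 - (\<alpha> i * (py i \<xi>)\<^sup>2 / 2 + \<beta> i * py i \<xi>) / c i - \<delta> i)) \<le>
          (\<Sum>i\<in>N. f i * py i \<xi> + ((px i (D \<xi>) * py i \<xi> + px i \<xi> * py i (D \<xi>)) / 2 -
            (\<alpha> i * py i \<xi> + \<beta> i) * py i (D \<xi>) / c i))" by (rule sum_mono)
        then show ?thesis
          unfolding V_def V'_def Dz by (simp only: distrib_left sum_distrib_left sum.distrib)
      qed
      ultimately show ?thesis by (simp add: W_def \<xi>_def)
    qed
    define a where "a = (\<Sum>i\<in>N. \<delta> i)"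
    have V: "V (s *\<^sub>R Z) = s - a" for s
      by (simp add: V_def a_def linear_scale[OF pz(1)] pzv linear_scale[OF lin(1)] linear_scale[OF lin(2)]
          pv sum_negf cong: sum.cong)
    show "0 \<le> W (hexp (a *\<^sub>R Z))" "W (hexp ((a - 1) *\<^sub>R Z)) < 0"
      by (simp_all add: W_def V)
  qed
qed

section \<open>Controllability criteria\<close>

text \<open>All brackets are multiples of \<open>Z\<close>, so the space spanned by \<open>Z\<close> and the \<open>D\<^sup>k B\<^sub>j\<close> is already a Lie
  algebra: the rank condition is Kalman's condition modulo the center.\<close>

lemma reach_space_eq_UNIV:
  assumes "rank_condition \<X> J B" "0 \<notin> J"
  shows "reach_space D (B(0 := Z)) (insert 0 J) = UNIV"
proof -
  let ?W = "reach_space D (B(0 := Z)) (insert 0 J)"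
  have gen: "(D ^^ k) ((B(0 := Z)) j) \<in> ?W" if "j \<in> insert 0 J" for k j
    unfolding reach_space_def using that by (intro span_base) blast
  have "lie_subalgebra ?W"
    unfolding lie_subalgebra_def
  proof (intro conjI ballI)
    show sub: "subspace ?W" by (simp add: reach_space_def)
    show "lie \<xi> \<eta> \<in> ?W" for \<xi> \<eta>
      unfolding lie_symp using gen[of 0 0] sub by (simp add: subspace_scale)
  qed
  moreover have "(D ^^ k) (B j) \<in> ?W" if "j \<in> J" for k j
    using gen[of j k] that assms(2) by (metis fun_upd_other insertI2)
  ultimately have "lie_subalgebra hull {(D ^^ k) (B j) | k j. j \<in> J} \<subseteq> ?W"
    by (intro hull_minimal) auto
  then show ?thesis using assms(1) by (auto simp: rank_condition_def)
qed

text \<open>Fast and slow loops of the one cell move the center in opposite directions.\<close>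

lemma cell_controllable_if:
  assumes i: "i \<noteq> 0"
    and c: "D (B i) = c *\<^sub>R Y i" and bdf: "D (Y i) = b *\<^sub>R B i + d *\<^sub>R Y i + f *\<^sub>R Z"
    and lie: "lie (B i) (Y i) = Z" and c0: "c \<noteq> 0"
    and cond: "d\<^sup>2 + 4 * b * c < 0 \<or> d = 0 \<and> f \<noteq> 0"
  shows "cell_controllable \<X> B Y Z i"
proof -
  define L where "L = span {B i, Y i, Z}"
  have sub: "subspace L" and mem: "B i \<in> L" "Y i \<in> L" "Z \<in> L"
    by (simp_all add: L_def span_base)
  have alg: "lie_subalgebra L"
    unfolding lie_subalgebra_def using sub mem lie_symp by (simp add: subspace_scale)
  have "D ` L \<subseteq> L"
  proof -
    have "D ` {B i, Y i, Z} \<subseteq> L"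
      using sub mem by (auto simp: c bdf D_Z intro!: subspace_add subspace_scale)
    then have "span (D ` {B i, Y i, Z}) \<subseteq> L" using sub by (rule span_minimal)
    then show ?thesis unfolding L_def linear_span_image[OF linear_D, symmetric] .
  qed
  then have inv: "(D ^^ k) \<xi> \<in> L" if "\<xi> \<in> L" for k \<xi>
    using that by (induction k) auto
  have W: "reach_space D (B(0 := Z)) (insert 0 {i}) = L" (is "?W = L")
  proof
    show "?W \<subseteq> L" unfolding reach_space_def
    proof (intro span_minimal sub subsetI)
      fix w assume "w \<in> {(D ^^ k) ((B(0 := Z)) j) | k j. j \<in> insert 0 {i}}"
      then obtain k j where w: "w = (D ^^ k) ((B(0 := Z)) j)" and j: "j \<in> {0, i}" by blast
      have "(B(0 := Z)) j \<in> L" using j mem by auto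
      then show "w \<in> L" unfolding w by (rule inv)
    qed
    have gen: "(D ^^ k) ((B(0 := Z)) j) \<in> ?W" if "j \<in> {0, i}" for k j
      unfolding reach_space_def using that by (intro span_base) blast
    have W: "subspace ?W" by (simp add: reach_space_def)
    have "Y i \<in> ?W"
      using subspace_scale[OF W gen[of i 1], of "inverse c"] i c0 by (simp add: c)
    then show "L \<subseteq> ?W" unfolding L_def
      using gen[of 0 0] gen[of i 0] i W by (intro span_minimal) auto
  qed
  have pos: "\<exists>\<kappa>>0. \<forall>I z0. c * I \<ge> 0 \<longrightarrow>
     steers (hexp ` L) \<X> {i} B (hexp (z0 *\<^sub>R Z)) (hexp ((\<kappa> * (z0 + I)) *\<^sub>R Z))"
    by (rule cell_gains_sign[where B = B and i = i, OF _ _ sub mem c bdf lie c0]) auto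
  have neg: "\<exists>\<kappa>>0. \<forall>I z0. c * I \<le> 0 \<longrightarrow>
     steers (hexp ` L) \<X> {i} B (hexp (z0 *\<^sub>R Z)) (hexp ((\<kappa> * (z0 + I)) *\<^sub>R Z))"
    by (rule cell_gains_opposite_sign[where B = B and i = i, OF _ _ sub mem c bdf lie c0 cond]) auto
  have "steers (hexp ` L) \<X> {i} B (hexp (a *\<^sub>R Z)) (hexp (b *\<^sub>R Z))" for a b
  proof (cases "c > 0")
    case True
    then show ?thesis
      using pos neg by (intro steers_vertical) (simp_all add: zero_le_mult_iff mult_le_0_iff)
  next
    case False
    then have "c < 0" using c0 by simp
    then show ?thesis
      using pos neg by (intro steers_vertical) (simp_all add: zero_le_mult_iff mult_le_0_iff)
  qed
  then have "controllable (hexp ` L) \<X> {i} B"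
    using controllable_if_vertical[OF _ _ sub mem(3) W] i by simp
  then show ?thesis
    unfolding cell_controllable_def L_def[symmetric] lie_subgroup_eq[OF alg] .
qed

text \<open>Fast loops of two cells with coefficients of opposite signs move the center in both directions.\<close>

lemma controllable_if_opposite_cells:
  assumes J: "finite J" "0 \<notin> J" and rank: "rank_condition \<X> J B"
    and c: "\<And>i. i \<in> I \<Longrightarrow> D (B i) = c i *\<^sub>R Y i"
    and bdf: "\<And>i. i \<in> I \<Longrightarrow> D (Y i) = b i *\<^sub>R B i + d *\<^sub>R Y i + f i *\<^sub>R Z"
    and lie: "\<And>i. i \<in> I \<Longrightarrow> lie (B i) (Y i) = Z"
    and I: "I \<subseteq> J" and i: "i \<in> I" "c i > 0" and j: "j \<in> I" "c j < 0"
  shows "controllable UNIV \<X> J B"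
proof -
  have gain: "\<exists>\<kappa>>0. \<forall>a z0. c k * a \<ge> 0 \<longrightarrow>
     steers (hexp ` UNIV) \<X> J B (hexp (z0 *\<^sub>R Z)) (hexp ((\<kappa> * (z0 + a)) *\<^sub>R Z))"
    if "k \<in> I" "c k \<noteq> 0" for k
    using I that J
    by (intro cell_gains_sign[where B = B and i = k, OF _ _ _ _ _ _ c bdf lie]) auto
  have "steers (hexp ` UNIV) \<X> J B (hexp (a *\<^sub>R Z)) (hexp (b *\<^sub>R Z))" for a b
    using gain[of i] gain[of j] i j
    by (intro steers_vertical) (simp_all add: zero_le_mult_iff)
  then have "controllable (hexp ` UNIV) \<X> J B"
    by (intro controllable_if_vertical[OF J _ _ reach_space_eq_UNIV[OF rank J(2)]]) auto
  then show ?thesis by (simp only: range_hexp)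
qed

end

lemma has_matrix_3:
  assumes "has_matrix F (vector [p, q, r] :: 'a::real_vector ^ 3)
    (vector [vector [a11, a12, a13], vector [a21, a22, a23], vector [a31, a32, a33]])"
  shows "F p = a11 *\<^sub>R p + a21 *\<^sub>R q + a31 *\<^sub>R r"
    and "F q = a12 *\<^sub>R p + a22 *\<^sub>R q + a32 *\<^sub>R r"
    and "F r = a13 *\<^sub>R p + a23 *\<^sub>R q + a33 *\<^sub>R r"
  using assms unfolding has_matrix_def by (simp_all add: forall_3 sum_3)

theorem theorem10:
  fixes \<X> :: "'n::finite heis \<Rightarrow> 'n heis"
    and B X Y :: "nat \<Rightarrow> 'n heis" and Z :: "'n heis"
    and b c f :: "nat \<Rightarrow> real" and d :: real
    and m m1 :: nat
  assumes "linear_field \<X>"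
    and "2 \<le> m1" and "m1 \<le> m" and "m \<le> CARD('n)"
    and "inj_on B {1..m}" and "independent (B ` {1..m})"
    and "\<forall>i\<in>{1..m}. \<forall>j\<in>{1..m}. lie (B i) (B j) = 0"
    and "rank_condition \<X> {1..m} B"
    and "symplectic_basis X Y Z"
    and "\<forall>i\<in>{1..m}. X i = B i"
    and "\<forall>i\<in>{1..m1}. decoupled_cell \<X> B Y Z i"
    and "\<forall>i\<in>{1..m1}. has_matrix (derivation \<X>) (vector [B i, Y i, Z] :: 'n heis ^ 3)
           (vector [vector [0,   b i, 0],
                    vector [c i, d,   0],
                    vector [0,   f i, d]])"
    and "\<forall>i\<in>{1..m1}. c i \<noteq> 0" and "c 1 = 1"
  shows "((\<forall>i\<in>{1..m1}. \<not> cell_controllable \<X> B Y Z i) \<and> (\<exists>i\<in>{1..m1}. c i < 0)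
            \<longrightarrow> controllable UNIV \<X> {1..m} B)
       \<and> (m1 = m \<and> m = CARD('n) \<and> (\<forall>i\<in>{1..CARD('n)}. \<not> cell_controllable \<X> B Y Z i)
            \<longrightarrow> (controllable UNIV \<X> {1..m} B \<longleftrightarrow> (\<exists>i\<in>{1..CARD('n)}. c i < 0)))"
proof -
  note \<X> = assms(1) and m1 = assms(2) and m1_le = assms(3) and m_le = assms(4) and rank = assms(8)
    and basis = assms(9) and XB = assms(10) and mat = assms(12) and c_nz = assms(13) and c_1 = assms(14)
  have Z: "Z \<noteq> 0" "Z \<in> lie_center"
  proof -
    have "independent (X ` {1..CARD('n)} \<union> Y ` {1..CARD('n)} \<union> {Z})" "span {Z} = lie_center"
      using basis unfolding symplectic_basis_def Let_def by blast+
    then show "Z \<noteq> 0" "Z \<in> lie_center"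
      using dependent_zero[of "X ` {1..CARD('n)} \<union> Y ` {1..CARD('n)} \<union> {Z}"]
        span_base[of Z "{Z}"] by blast+
  qed
  have D: "derivation \<X> (B i) = c i *\<^sub>R Y i"
    "derivation \<X> (Y i) = b i *\<^sub>R B i + d *\<^sub>R Y i + f i *\<^sub>R Z" "derivation \<X> Z = d *\<^sub>R Z"
    if "i \<in> {1..m1}" for i
    using has_matrix_3[OF mat[rule_format, OF that]] by simp_all
  interpret heis_system \<X> Z d
    using \<X> Z D(3)[of 1] m1 by unfold_locales auto
  have lie: "lie (B i) (Y i) = Z" if "i \<in> {1..m1}" for i
  proof -
    have i: "i \<in> {1..CARD('n)}" "i \<in> {1..m}" using that m1_le m_le by auto
    then have "lie (X i) (Y i) = Z"
      using basis unfolding symplectic_basis_def Let_def by presburger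
    then show ?thesis using XB i(2) by simp
  qed
  have controllable: "controllable UNIV \<X> {1..m} B" if "i \<in> {1..m1}" "c i < 0" for i
    by (rule controllable_if_opposite_cells[where I = "{1..m1}" and i = 1 and j = i, OF _ _ rank D(1,2) lie])
      (use that m1 m1_le c_1 in auto)
  moreover have "\<exists>i\<in>{1..CARD('n)}. c i < 0"
    if m: "m1 = m" "m = CARD('n)" and cells: "\<forall>i\<in>{1..CARD('n)}. \<not> cell_controllable \<X> B Y Z i"
      and contr: "controllable UNIV \<X> {1..m} B"
  proof (rule ccontr)
    assume "\<not> (\<exists>i\<in>{1..CARD('n)}. c i < 0)"
    then have pos: "c i > 0" if "i \<in> {1..CARD('n)}" for i
      using that c_nz m by (metis linorder_neqE_linordered_idom)
    have noncontr: "d\<^sup>2 + 4 * b i * c i \<ge> 0" "d \<noteq> 0 \<or> f i = 0" if "i \<in> {1..CARD('n)}" for i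
    proof -
      have i: "i \<in> {1..m1}" "i \<noteq> 0" using that m by auto
      have "\<not> (d\<^sup>2 + 4 * b i * c i < 0 \<or> d = 0 \<and> f i \<noteq> 0)"
        using cell_controllable_if[where i = i and B = B and Y = Y, 
            OF i(2) D(1,2)[OF i(1)] lie[OF i(1)]] cells that pos[OF that] by auto
      then show "d\<^sup>2 + 4 * b i * c i \<ge> 0" "d \<noteq> 0 \<or> f i = 0" by auto
    qed
    have XB': "X i = B i" if "i \<in> {1..CARD('n)}" for i using XB that m by blast
    have "\<not> controllable UNIV \<X> {1..CARD('n)} X"
      by (rule not_controllable_decoupled[OF basis, where b = b and c = c and f = f])
        (use D m XB' pos noncontr in auto)
    moreover have "controllable UNIV \<X> {1..CARD('n)} X \<longleftrightarrow> controllable UNIV \<X> {1..CARD('n)} B"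
    proof -
      have "(\<Sum>j\<in>{1..CARD('n)}. v j *\<^sub>R rinv (X j) g) = (\<Sum>j\<in>{1..CARD('n)}. v j *\<^sub>R rinv (B j) g)"
        for v :: "nat \<Rightarrow> real" and g
        by (rule sum.cong) (simp_all add: XB')
      then show ?thesis unfolding controllable_def trajectory_def by (simp only:)
    qed
    ultimately show False using contr m by simp
  qed
  ultimately show ?thesis using m1_le by (metis (no_types, lifting))
qed

end
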